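(* Let $\Lambda\subset\mathbb{Q}^2$ be a rational lattice. There is an algorithm that, given $n>0$, a point $\mathbf p\in H_n$, and the standard basis $\mathbf b_1,\mathbf b_2$ of $\Lambda$, computes $\mathrm{Nextpt}(\mathbf p)$. If $\Lambda$ is a reduced sublattice of $\mathbb{Z}^2$, the number of arithmetic operations taken by the algorithm is in $O(\log(n+\det\Lambda))$, except possibly when $\mathbf p_y\in(1,2)$.
   Context: $H_n:=\{(x,y)\in\mathbb{R}_{\ge0}^2: xy\ge n\}$ and $H_{n,\mathbf p+\Lambda}:=H_n\cap(\mathbf p+\Lambda)$. The standard basis of $\Lambda$ is the basis $\mathbf b_1,\mathbf b_2=(0,(\mathbf b_2)_y)$ with $(\mathbf b_1)_x>0$, $(\mathbf b_2)_y>0$, $0\le(\mathbf b_1)_y<(\mathbf b_2)_y$. A sublattice $\Lambda\subseteq\mathbb{Z}^2$ is reduced if both coordinate projections of $\Lambda$ equal $\mathbb{Z}$. $\mathrm{Minsl}(\mathbf p)$ is the primitive nonzero vector of $\Lambda$ of smallest slope (vertical downward vectors having slope $-\infty$) among directions of nonzero vectors in $(H_{n,\mathbf p+\Lambda}-\mathbf p)\cap\{x\ge0\}$; $\mathrm{Nextpt}(\mathbf p):=\mathbf p+k\,\mathrm{Minsl}(\mathbf p)$ with $k=\max\{j\in\mathbb{Z}:\mathbf p+j\,\mathrm{Minsl}(\mathbf p)\in H_n\}$, and $\mathrm{Nextpt}(\mathbf p)=\infty$ if $k=\infty$. Arithmetic model: comparisons, $+,-,\times$, integer division and integer square root cost $O(1)$.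 *)

theory Defs
  imports "HOL-Analysis.Analysis"
begin

type_synonym point = "real \<times> real"

definition lattice_basis :: "point set \<Rightarrow> point \<Rightarrow> point \<Rightarrow> bool" where
  "lattice_basis L b1 b2 \<longleftrightarrow>
     b1 \<noteq> b2 \<and> independent {b1, b2} \<and>
     L = {of_int i *\<^sub>R b1 + of_int j *\<^sub>R b2 | i j :: int. True}"

definition rational_lattice :: "point set \<Rightarrow> bool" where
  "rational_lattice L \<longleftrightarrow> (\<exists>b1 b2. lattice_basis L b1 b2) \<and> L \<subseteq> \<rat> \<times> \<rat>"

definition standard_basis :: "point set \<Rightarrow> point \<Rightarrow> point \<Rightarrow> bool" where
  "standard_basis L b1 b2 \<longleftrightarrow>
     lattice_basis L b1 b2 \<and> fst b2 = 0 \<and> fst b1 > 0 \<and> snd b2 > 0 \<and>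
     0 \<le> snd b1 \<and> snd b1 < snd b2"

definition reduced_lattice :: "point set \<Rightarrow> bool" where
  "reduced_lattice L \<longleftrightarrow> L \<subseteq> \<int> \<times> \<int> \<and> fst ` L = \<int> \<and> snd ` L = \<int>"

definition basis_det :: "point \<Rightarrow> point \<Rightarrow> real" where
  "basis_det b1 b2 = \<bar>fst b1 * snd b2 - snd b1 * fst b2\<bar>"

definition lattice_det :: "point set \<Rightarrow> real" where
  "lattice_det L = (THE d. \<exists>b1 b2. lattice_basis L b1 b2 \<and> d = basis_det b1 b2)"

lemma basis_det_multiple:
  assumes "lattice_basis L b1 b2" "lattice_basis L c1 c2"
  obtains m :: nat where "basis_det c1 c2 = real m * basis_det b1 b2"
proof -
  have L: "L = {of_int i *\<^sub>R b1 + of_int j *\<^sub>R b2 | i j :: int. True}"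
    and M: "L = {of_int i *\<^sub>R c1 + of_int j *\<^sub>R c2 | i j :: int. True}"
    using assms by (simp_all add: lattice_basis_def)
  have "of_int 1 *\<^sub>R c1 + of_int 0 *\<^sub>R c2 \<in> L" "of_int 0 *\<^sub>R c1 + of_int 1 *\<^sub>R c2 \<in> L"
    unfolding M by blast+
  then have "c1 \<in> L" "c2 \<in> L" by simp_all
  then obtain i j k l :: int
    where c: "c1 = of_int i *\<^sub>R b1 + of_int j *\<^sub>R b2" "c2 = of_int k *\<^sub>R b1 + of_int l *\<^sub>R b2"
    unfolding L by blast
  have "fst c1 * snd c2 - snd c1 * fst c2
      = of_int (i * l - j * k) * (fst b1 * snd b2 - snd b1 * fst b2)"
    by (simp add: c algebra_simps)
  then have "basis_det c1 c2 = real (nat \<bar>i * l - j * k\<bar>) * basis_det b1 b2"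
    by (simp add: basis_det_def abs_mult)
  then show thesis by (rule that)
qed

lemma lattice_det_eq:
  assumes "lattice_basis L b1 b2"
  shows "lattice_det L = basis_det b1 b2"
  unfolding lattice_det_def
proof (rule the_equality)
  show "\<exists>c1 c2. lattice_basis L c1 c2 \<and> basis_det b1 b2 = basis_det c1 c2"
    using assms by blast
next
  fix d assume "\<exists>c1 c2. lattice_basis L c1 c2 \<and> d = basis_det c1 c2"
  then obtain c1 c2 where c: "lattice_basis L c1 c2" and d: "d = basis_det c1 c2" by blast
  obtain m where m: "basis_det c1 c2 = real m * basis_det b1 b2"
    using basis_det_multiple[OF assms c] .
  obtain k where k: "basis_det b1 b2 = real k * basis_det c1 c2"
    using basis_det_multiple[OF c assms] .
  show "d = basis_det b1 b2"
  proof (cases "basis_det b1 b2 = 0")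
    case True
    then show ?thesis using m d by simp
  next
    case False
    have "basis_det b1 b2 = real (k * m) * basis_det b1 b2" using m k by (simp add: mult.assoc)
    then have "real (k * m) = 1" using False by (metis mult_cancel_right1)
    then have "k * m = 1" by (metis of_nat_eq_1_iff)
    then show ?thesis using m d by simp
  qed
qed

definition hyp :: "real \<Rightarrow> point set" where
  "hyp n = {(x, y). 0 \<le> x \<and> 0 \<le> y \<and> n \<le> x * y}"

definition hyp_lattice :: "real \<Rightarrow> point \<Rightarrow> point set \<Rightarrow> point set" where
  "hyp_lattice n p L = hyp n \<inter> (+) p ` L"

definition slope :: "point \<Rightarrow> ereal" where
  "slope v = (if fst v = 0 then (if snd v < 0 then -\<infinity> else \<infinity>) else ereal (snd v / fst v))"

definition primitive_vec :: "point set \<Rightarrow> point \<Rightarrow> bool" where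
  "primitive_vec L v \<longleftrightarrow>
     v \<in> L \<and> v \<noteq> 0 \<and> (\<forall>w\<in>L. \<forall>k::int. v = of_int k *\<^sub>R w \<longrightarrow> \<bar>k\<bar> = 1)"

definition steps_right :: "real \<Rightarrow> point set \<Rightarrow> point \<Rightarrow> point set" where
  "steps_right n L p = {v \<in> (\<lambda>q. q - p) ` hyp_lattice n p L. v \<noteq> 0 \<and> fst v \<ge> 0}"

definition is_minsl :: "real \<Rightarrow> point set \<Rightarrow> point \<Rightarrow> point \<Rightarrow> bool" where
  "is_minsl n L p v \<longleftrightarrow>
     primitive_vec L v \<and>
     (\<exists>u \<in> steps_right n L p. \<exists>t>0. v = t *\<^sub>R u) \<and>
     (\<forall>u \<in> steps_right n L p. slope v \<le> slope u)"

definition minsl :: "real \<Rightarrow> point set \<Rightarrow> point \<Rightarrow> point" where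
  "minsl n L p = (THE v. is_minsl n L p v)"

text \<open>The value \<open>None\<close> stands for the point \<open>\<infinity>\<close>.\<close>

definition nextpt :: "real \<Rightarrow> point set \<Rightarrow> point \<Rightarrow> point option" where
  "nextpt n L p =
     (let m = minsl n L p; J = {j::int. p + of_int j *\<^sub>R m \<in> hyp n}
      in if bdd_above J then Some (p + of_int (GREATEST j. j \<in> J) *\<^sub>R m) else None)"

text \<open>
  The arithmetic model: while programs over finitely many number-valued variables.
  The only constants are integers, so that a program cannot hide information in a constant.
  Integer division is \<open>\<lfloor>a / b\<rfloor>\<close> and the integer square root is \<open>\<lfloor>sqrt a\<rfloor>\<close>. All operations map
  rationals to rationals, and on fractions of integers each one amounts to boundedly many of the
  same operations on integers. Each arithmetic operation and each comparison costs one unit.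
\<close>

datatype aexp =
    Const int
  | Var nat
  | Add aexp aexp
  | Sub aexp aexp
  | Mul aexp aexp
  | IDiv aexp aexp
  | ISqrt aexp

datatype bexp =
    Less aexp aexp
  | Leq aexp aexp
  | Eq aexp aexp
  | Neg bexp
  | Conj bexp bexp

datatype com =
    Skip
  | Assign nat aexp
  | Seq com com
  | Cond bexp com com
  | While bexp com

type_synonym state = "nat \<Rightarrow> real"

fun aval :: "aexp \<Rightarrow> state \<Rightarrow> real" where
  "aval (Const k) s = of_int k"
| "aval (Var x) s = s x"
| "aval (Add a b) s = aval a s + aval b s"
| "aval (Sub a b) s = aval a s - aval b s"
| "aval (Mul a b) s = aval a s * aval b s"
| "aval (IDiv a b) s = of_int \<lfloor>aval a s / aval b s\<rfloor>"
| "aval (ISqrt a) s = of_int \<lfloor>sqrt (aval a s)\<rfloor>"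

fun acost :: "aexp \<Rightarrow> nat" where
  "acost (Const k) = 0"
| "acost (Var x) = 0"
| "acost (Add a b) = acost a + acost b + 1"
| "acost (Sub a b) = acost a + acost b + 1"
| "acost (Mul a b) = acost a + acost b + 1"
| "acost (IDiv a b) = acost a + acost b + 1"
| "acost (ISqrt a) = acost a + 1"

fun bval :: "bexp \<Rightarrow> state \<Rightarrow> bool" where
  "bval (Less a b) s \<longleftrightarrow> aval a s < aval b s"
| "bval (Leq a b) s \<longleftrightarrow> aval a s \<le> aval b s"
| "bval (Eq a b) s \<longleftrightarrow> aval a s = aval b s"
| "bval (Neg b) s \<longleftrightarrow> \<not> bval b s"
| "bval (Conj b c) s \<longleftrightarrow> bval b s \<and> bval c s"

fun bcost :: "bexp \<Rightarrow> nat" where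
  "bcost (Less a b) = acost a + acost b + 1"
| "bcost (Leq a b) = acost a + acost b + 1"
| "bcost (Eq a b) = acost a + acost b + 1"
| "bcost (Neg b) = bcost b"
| "bcost (Conj b c) = bcost b + bcost c"

text \<open>\<open>exec c s t s'\<close>: started in \<open>s\<close>, \<open>c\<close> halts in \<open>s'\<close> after \<open>t\<close> operations.\<close>

inductive exec :: "com \<Rightarrow> state \<Rightarrow> nat \<Rightarrow> state \<Rightarrow> bool" where
  Skip: "exec Skip s 0 s"
| Assign: "exec (Assign x a) s (acost a) (s(x := aval a s))"
| Seq: "exec c1 s t1 s1 \<Longrightarrow> exec c2 s1 t2 s2 \<Longrightarrow> exec (Seq c1 c2) s (t1 + t2) s2"
| CondTrue: "bval b s \<Longrightarrow> exec c1 s t s1 \<Longrightarrow> exec (Cond b c1 c2) s (bcost b + t) s1"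
| CondFalse: "\<not> bval b s \<Longrightarrow> exec c2 s t s1 \<Longrightarrow> exec (Cond b c1 c2) s (bcost b + t) s1"
| WhileFalse: "\<not> bval b s \<Longrightarrow> exec (While b c) s (bcost b) s"
| WhileTrue: "bval b s \<Longrightarrow> exec c s t1 s1 \<Longrightarrow> exec (While b c) s1 t2 s2 \<Longrightarrow>
    exec (While b c) s (bcost b + t1 + t2) s2"

inductive_cases SkipE: "exec Skip s t s'"
inductive_cases AssignE: "exec (Assign x a) s t s'"
inductive_cases SeqE: "exec (Seq c1 c2) s t s'"
inductive_cases CondE: "exec (Cond b c1 c2) s t s'"
inductive_cases WhileE: "exec (While b c) s t s'"

lemma exec_deterministic:
  "exec c s t s1 \<Longrightarrow> exec c s u s2 \<Longrightarrow> t = u \<and> s1 = s2"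
proof (induction arbitrary: u s2 rule: exec.induct)
  case (Skip s)
  then show ?case by (auto elim: SkipE)
next
  case (Assign x a s)
  then show ?case by (auto elim: AssignE)
next
  case (Seq c1 s t1 s1 c2 t2 s2')
  from Seq.prems show ?case by (rule SeqE) (use Seq.IH in blast)
next
  case (CondTrue b s c1 t s1 c2)
  from CondTrue.prems show ?case by (rule CondE) (use CondTrue.hyps CondTrue.IH in blast)+
next
  case (CondFalse b s c2 t s1 c1)
  from CondFalse.prems show ?case by (rule CondE) (use CondFalse.hyps CondFalse.IH in blast)+
next
  case (WhileFalse b s c)
  from WhileFalse.prems show ?case by (rule WhileE) (use WhileFalse.hyps in blast)+
next
  case (WhileTrue b s c t1 s1 t2 s2')
  from WhileTrue.prems show ?case by (rule WhileE) (use WhileTrue.hyps WhileTrue.IH in blast)+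
qed

text \<open>
  Variables \<open>0, \<dots>, 6\<close> hold the input and all others start at \<open>0\<close>. On halting, variable \<open>0\<close> is zero
  if the result is \<open>\<infinity>\<close>; otherwise the result is the point held in variables \<open>1\<close> and \<open>2\<close>.
\<close>

definition input_state :: "real \<Rightarrow> point \<Rightarrow> point \<Rightarrow> point \<Rightarrow> state" where
  "input_state n p b1 b2 i =
     (let xs = [n, fst p, snd p, fst b1, snd b1, fst b2, snd b2]
      in if i < length xs then xs ! i else 0)"

definition result :: "state \<Rightarrow> point option" where
  "result s = (if s 0 = 0 then None else Some (s 1, s 2))"

end

theory Submission
  imports Defs
begin

text \<open>
  Call a vector \<open>v\<close> feasible if \<open>p + v\<close> lies in the convex region \<open>H\<^sub>n\<close>. The algorithm keeps a basis
  \<open>u, w\<close> of the lattice with \<open>u\<close> feasible, \<open>w\<close> infeasible and every feasible vector of smaller slope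
  than \<open>u\<close> in the cone between them. By convexity, if that cone contains a feasible lattice vector
  below \<open>u\<close> at all, then it contains one of the form \<open>w + c u\<close>. So one replaces \<open>w\<close> by the last
  infeasible \<open>w + a u\<close> before the first feasible one and then \<open>u\<close> by the last feasible \<open>u + k w\<close>, as
  in the Euclidean algorithm, and stops when no \<open>w + c u\<close> is feasible; then \<open>u\<close> has minimal slope.

  The numbers \<open>a\<close> and \<open>k\<close> are found by doubling and bisection in \<open>O(1 + log (1 + a) + log (1 + k))\<close>
  operations. One round multiplies the first coordinate of \<open>u\<close> by at least \<open>1 + a k\<close> with
  \<open>a, k \<ge> 1\<close>, so the total cost is logarithmic in its final value, which for reduced lattices is at
  most \<open>(1 + n + det \<Lambda>)\<^sup>2\<close>. The last bound needs a feasible vector with second coordinate \<open>-1\<close> and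
  first coordinate at most \<open>n + det \<Lambda>\<close>; it exists for \<open>p\<^sub>y \<ge> 2\<close>, while for \<open>p\<^sub>y \<le> 1\<close> the vector
  \<open>u\<close> never descends.
\<close>

section \<open>The hyperbola region\<close>

definition cross :: "point \<Rightarrow> point \<Rightarrow> real" where
  "cross u v = fst u * snd v - snd u * fst v"

lemma cross_bilinear [simp]:
  "cross u (v + w) = cross u v + cross u w"
  "cross (v + w) u = cross v u + cross w u"
  "cross u (t *\<^sub>R v) = t * cross u v"
  "cross (t *\<^sub>R v) u = t * cross v u"
  "cross u u = 0"
  by (simp_all add: cross_def algebra_simps)

lemma cross_commute: "cross u v = - cross v u"
  by (simp add: cross_def)

text \<open>For vectors pointing right, \<open>cross u v \<le> 0\<close> means that \<open>v\<close>
  has at most the slope of \<open>u\<close>, so this is transitivity of the slope order after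
  dividing by first coordinates.\<close>

lemma cross_nonpos_trans:
  assumes "cross u v \<le> 0" "cross v w \<le> 0" "fst u > 0" "fst v > 0" "fst w > 0"
  shows "cross u w \<le> 0"
proof -
  have "snd v / fst v \<le> snd u / fst u" "snd w / fst w \<le> snd v / fst v"
    using assms by (auto simp: cross_def field_simps)
  then have "snd w / fst w \<le> snd u / fst u" by linarith
  then show ?thesis using assms by (auto simp: cross_def field_simps)
qed

lemma convex_hyp:
  assumes "n \<ge> 0"
  shows "convex (hyp n)"
proof (rule convexI)
  fix q r :: point and s t :: real
  assume qr: "q \<in> hyp n" "r \<in> hyp n" and st: "0 \<le> s" "0 \<le> t" "s + t = 1"
  obtain a b c d where q: "q = (a, b)" and r: "r = (c, d)" by fastforce
  have pos: "0 \<le> a" "0 \<le> b" "0 \<le> c" "0 \<le> d" "n \<le> a * b" "n \<le> c * d"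
    using qr by (auto simp: hyp_def q r)
  \<comment> \<open>AM-GM for \<open>a * d\<close> and \<open>c * b\<close>, whose product is at
    least \<open>n\<^sup>2\<close>; it controls the mixed term in the product of the coordinates of
    a convex combination.\<close>
  have "(2 * n)\<^sup>2 \<le> 4 * ((a * b) * (c * d))"
    using mult_mono[OF pos(5,6)] assms pos by (simp add: power2_eq_square)
  also have "\<dots> \<le> (a * d + c * b)\<^sup>2"
    using zero_le_power2[of "a * d - c * b"] by (simp add: power2_eq_square algebra_simps)
  finally have "(2 * n)\<^sup>2 \<le> (a * d + c * b)\<^sup>2" .
  moreover have "0 \<le> a * d + c * b" using pos by simp
  ultimately have mixed: "2 * n \<le> a * d + c * b" by (rule power2_le_imp_le)
  have "n = s * s * n + t * t * n + s * t * (2 * n)"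
    using arg_cong[OF st(3), of "\<lambda>z. z * z * n"] by (simp add: algebra_simps)
  also have "\<dots> \<le> s * s * (a * b) + t * t * (c * d) + s * t * (a * d + c * b)"
    using pos st mixed by (intro add_mono mult_left_mono) auto
  also have "\<dots> = (s * a + t * c) * (s * b + t * d)"
    by (simp add: algebra_simps)
  finally show "s *\<^sub>R q + t *\<^sub>R r \<in> hyp n"
    using pos st by (simp add: hyp_def q r)
qed

lemma hyp_iff:
  assumes "n > 0" "fst q > 0"
  shows "q \<in> hyp n \<longleftrightarrow> n \<le> fst q * snd q"
proof -
  have "0 \<le> snd q" if "n \<le> fst q * snd q"
    using that assms by (metis less_le_trans less_imp_le zero_less_mult_pos)
  then show ?thesis using assms by (cases q) (auto simp: hyp_def)
qed

lemma hyp_pos: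
  assumes "n > 0" "q \<in> hyp n"
  shows "fst q > 0" "snd q > 0"
proof -
  have "0 \<le> fst q" "0 \<le> snd q" "0 < fst q * snd q" using assms by (auto simp: hyp_def)
  then show "fst q > 0" "snd q > 0" by (auto simp: zero_less_mult_iff)
qed

lemma hyp_add_nonneg:
  assumes "n > 0" "q \<in> hyp n" "fst v \<ge> 0" "snd v \<ge> 0"
  shows "q + v \<in> hyp n"
proof -
  have "fst q * snd q \<le> (fst q + fst v) * (snd q + snd v)"
    using hyp_pos[OF assms(1,2)] assms(3,4) by (intro mult_mono) auto
  then show ?thesis
    using assms hyp_pos[OF assms(1,2)] by (auto simp: hyp_iff)
qed

lemma hyp_segment:
  assumes "n \<ge> 0" "q \<in> hyp n" "q + t *\<^sub>R v \<in> hyp n" "0 \<le> s" "s \<le> t"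
  shows "q + s *\<^sub>R v \<in> hyp n"
proof (cases "t = 0")
  case True
  then show ?thesis using assms by simp
next
  case False
  have "(1 - s / t) *\<^sub>R q + (s / t) *\<^sub>R (q + t *\<^sub>R v) \<in> hyp n"
    using assms False by (intro convexD[OF convex_hyp]) (auto simp: field_simps)
  moreover have "(1 - s / t) *\<^sub>R q + (s / t) *\<^sub>R (q + t *\<^sub>R v) = q + s *\<^sub>R v"
    using False by (simp add: algebra_simps)
  ultimately show ?thesis by simp
qed

text \<open>
  Scaling \<open>p + e u + b w\<close> down to height one lands at the possibly fractional position \<open>e/b\<close> on the
  line \<open>p + w + \<real> u\<close>; moving towards \<open>p + u\<close> inside the triangle gains up to \<open>1 - 1/b\<close>, which is
  just enough to reach the next integer.
\<close>

lemma hyp_lattice_line: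
  fixes e b :: int
  assumes "n \<ge> 0" "p \<in> hyp n" "p + u \<in> hyp n"
    and "p + of_int e *\<^sub>R u + of_int b *\<^sub>R w \<in> hyp n" "b \<ge> 1"
  obtains c :: int where "e \<le> b * c" "b * c < e + b" "p + w + of_int c *\<^sub>R u \<in> hyp n"
proof -
  \<comment> \<open>The ceiling of \<open>e / b\<close>, written through floor division.\<close>
  define c where "c = - ((- e) div b)"
  have "b * ((- e) div b) + (- e) mod b = - e" by simp
  moreover have "0 \<le> (- e) mod b" "(- e) mod b < b" using assms(5) by simp_all
  ultimately have c: "e \<le> b * c" "b * c < e + b"
    unfolding c_def by (simp_all only: mult_minus_right)
  define B E C where "B = real_of_int b" and "E = real_of_int e" and "C = real_of_int c"
  have B: "B \<ge> 1" using assms(5) by (simp add: B_def)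
  have "real_of_int e \<le> of_int (b * c)" "real_of_int (b * c + 1) \<le> of_int (e + b)"
    using c by (simp_all only: of_int_le_iff)
  then have C: "E \<le> B * C" "B * C + 1 \<le> E + B" by (simp_all add: B_def E_def C_def)
  \<comment> \<open>\<open>s\<close> scales the far point down to height one and \<open>t\<close> is
    the distance left to the integer \<open>C\<close>. Integrality sharpened the strict upper bound
    on \<open>b * c\<close> to \<open>B * C + 1 \<le> E + B\<close>, which is exactly
    \<open>s + t \<le> 1\<close>.\<close>
  define s t where "s = 1 / B" and "t = C - E / B"
  have st: "s \<ge> 0" "t \<ge> 0" "s + t \<le> 1" using B C by (simp_all add: s_def t_def field_simps)
  have "(1 - s - t) *\<^sub>R p + t *\<^sub>R (p + u) + s *\<^sub>R (p + E *\<^sub>R u + B *\<^sub>R w) \<in> hyp n"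
  proof -
    have "convex hull {p, p + u, p + E *\<^sub>R u + B *\<^sub>R w} \<subseteq> hyp n"
      using assms by (intro hull_minimal convex_hyp) (auto simp: E_def B_def)
    then show ?thesis using st unfolding convex_hull_3 by force
  qed
  moreover have "(1 - s - t) *\<^sub>R p + t *\<^sub>R (p + u) + s *\<^sub>R (p + E *\<^sub>R u + B *\<^sub>R w)
      = p + (s * B) *\<^sub>R w + (s * E + t) *\<^sub>R u"
    by (simp add: scaleR_add_left scaleR_diff_left scaleR_add_right)
  moreover have "s * B = 1" "s * E + t = C" using B by (simp_all add: s_def t_def)
  ultimately have "p + w + C *\<^sub>R u \<in> hyp n" by (simp only: scaleR_one)
  then show thesis using that[OF c] by (simp only: C_def)
qed

section \<open>Vectors of minimal slope\<close>

text \<open>Generation only; independence enters separately as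
  \<open>cross u w \<noteq> 0\<close>.\<close>

definition spans :: "point set \<Rightarrow> point \<Rightarrow> point \<Rightarrow> bool" where
  "spans L u w \<longleftrightarrow> u \<in> L \<and> w \<in> L \<and>
     (\<forall>v\<in>L. \<exists>a b :: int. v = of_int a *\<^sub>R u + of_int b *\<^sub>R w)"

lemma steps_right_iff:
  "v \<in> steps_right n L p \<longleftrightarrow> v \<in> L \<and> p + v \<in> hyp n \<and> v \<noteq> 0 \<and> fst v \<ge> 0"
  by (auto simp: steps_right_def hyp_lattice_def image_iff intro!: bexI[of _ "p + v"])

text \<open>Links orientation with the case distinction in \<open>slope\<close>: a vertical
  \<open>u\<close> points down and has slope \<open>-\<infinity>\<close>, while a vertical
  \<open>v\<close> on the upper side of a right-pointing \<open>u\<close> must point up.\<close>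

lemma slope_le_of_cross:
  assumes "fst u > 0 \<or> fst u = 0 \<and> snd u < 0" "fst v > 0 \<or> fst v = 0 \<and> snd v \<noteq> 0"
    and "cross u v \<ge> 0"
  shows "slope u \<le> slope v" and "slope v \<le> slope u \<Longrightarrow> cross u v = 0"
  using assms by (auto simp: slope_def cross_def field_simps zero_le_mult_iff split: if_splits)

text \<open>Taking the cross product of \<open>u = k v\<close> with \<open>w\<close> turns
  \<open>cross w u\<close> into \<open>k * a\<close> times itself, where \<open>a\<close> is the
  coefficient of \<open>u\<close> in \<open>v\<close>; so \<open>k * a = 1\<close> over the
  integers.\<close>

lemma primitive_vecI:
  assumes "spans L u w" "cross u w \<noteq> 0"
  shows "primitive_vec L u"
  unfolding primitive_vec_def
proof (intro conjI ballI allI impI)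
  show "u \<in> L" using assms by (simp add: spans_def)
  show "u \<noteq> 0" using assms by (auto simp: cross_def)
  fix v and k :: int assume v: "v \<in> L" "u = of_int k *\<^sub>R v"
  obtain a b :: int where ab: "v = of_int a *\<^sub>R u + of_int b *\<^sub>R w"
    using assms v by (auto simp: spans_def)
  have "cross w u = of_int k * cross w v" by (subst v(2)) simp
  also have "cross w v = of_int a * cross w u" by (simp add: ab)
  finally have "cross w u = of_int (k * a) * cross w u" by simp
  moreover have "cross w u \<noteq> 0" using assms by (subst cross_commute) simp
  ultimately have "real_of_int (k * a) = 1" by (metis mult_cancel_right1)
  then have "k * a = 1" by (metis of_int_eq_1_iff)
  then show "\<bar>k\<bar> = 1" by (auto simp: zmult_eq_1_iff)
qed

text \<open>Since \<open>minsl\<close> is a definite description, uniqueness matters too. A rival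
  has zero cross product with \<open>u\<close>, hence is an integer multiple of it; primitivity
  leaves \<open>u\<close> and \<open>- u\<close>, and the latter points left or straight up.\<close>

lemma minsl_eqI:
  assumes "spans L u w" "cross u w \<noteq> 0" "u \<in> steps_right n L p"
    and u: "fst u > 0 \<or> fst u = 0 \<and> snd u < 0"
    and least: "\<And>v. v \<in> steps_right n L p \<Longrightarrow> cross u v \<ge> 0"
  shows "minsl n L p = u"
  unfolding minsl_def
proof (rule the_equality)
  have ne: "fst v > 0 \<or> fst v = 0 \<and> snd v \<noteq> 0" if "v \<in> steps_right n L p" for v
    using that by (cases v) (auto simp: steps_right_iff zero_prod_def)
  have prim: "primitive_vec L u" using assms by (intro primitive_vecI)
  show "is_minsl n L p u"
    unfolding is_minsl_def
  proof (intro conjI ballI)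
    show "\<exists>v\<in>steps_right n L p. \<exists>t>0. u = t *\<^sub>R v"
      using assms(3) by (intro bexI[of _ u] exI[of _ 1]) auto
    fix v assume "v \<in> steps_right n L p"
    then show "slope u \<le> slope v" using slope_le_of_cross(1)[OF u ne least] by blast
  qed (fact prim)
  fix v assume v: "is_minsl n L p v"
  then obtain v' t where v': "v' \<in> steps_right n L p" "t > 0" "v = t *\<^sub>R v'"
    and primv: "primitive_vec L v" and "slope v \<le> slope u"
    using assms(3) by (auto simp: is_minsl_def)
  have "cross u v = t * cross u v'" by (simp add: v'(3))
  then have "cross u v \<ge> 0" using least[OF v'(1)] v'(2) by simp
  moreover have nev: "fst v > 0 \<or> fst v = 0 \<and> snd v \<noteq> 0" using ne[OF v'(1)] v' by auto
  ultimately have c0: "cross u v = 0"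
    using slope_le_of_cross(2)[OF u] \<open>slope v \<le> slope u\<close> by blast
  obtain a b :: int where ab: "v = of_int a *\<^sub>R u + of_int b *\<^sub>R w"
    using assms(1) primv by (auto simp: spans_def primitive_vec_def)
  have "b = 0" using c0 assms(2) by (simp add: ab)
  with ab have va: "v = of_int a *\<^sub>R u" by simp
  then have "\<bar>a\<bar> = 1" using primv assms(1) by (auto simp: primitive_vec_def spans_def)
  moreover have "a \<noteq> - 1"
    using va nev u \<open>slope v \<le> slope u\<close> by (auto simp: slope_def)
  ultimately have "a = 1" by linarith
  then show "v = u" using va by simp
qed

text \<open>By convexity the feasible nonnegative multiples have no gaps, so the first exit decides
  the maximum over all integers.\<close>

lemma nextpt_SomeI:
  fixes k :: nat
  assumes "n \<ge> 0" "p \<in> hyp n" "p + of_nat k *\<^sub>R minsl n L p \<in> hyp n"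
    and "p + of_nat (Suc k) *\<^sub>R minsl n L p \<notin> hyp n"
  shows "nextpt n L p = Some (p + of_nat k *\<^sub>R minsl n L p)"
proof -
  define J where "J = {j::int. p + of_int j *\<^sub>R minsl n L p \<in> hyp n}"
  have le: "j \<le> int k" if "j \<in> J" for j
  proof (rule ccontr)
    assume "\<not> j \<le> int k"
    then have "of_nat (Suc k) \<le> real_of_int j" by linarith
    then show False
      using hyp_segment[of n p "of_int j" "minsl n L p" "of_nat (Suc k)"] assms that
      by (simp add: J_def)
  qed
  have "int k \<in> J" using assms by (simp add: J_def)
  then have "(GREATEST j. j \<in> J) = int k" using le by (intro Greatest_equality)
  moreover have "bdd_above J" using le by (rule bdd_aboveI)
  ultimately show ?thesis by (simp add: nextpt_def Let_def J_def)
qed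

lemma nextpt_NoneI:
  assumes "n > 0" "p \<in> hyp n" "fst (minsl n L p) \<ge> 0" "snd (minsl n L p) \<ge> 0"
  shows "nextpt n L p = None"
proof -
  define J where "J = {j::int. p + of_int j *\<^sub>R minsl n L p \<in> hyp n}"
  have "j \<in> J" if "j \<ge> 0" for j
    using that assms by (auto simp: J_def intro!: hyp_add_nonneg)
  then have "\<not> bdd_above J"
    unfolding bdd_above_def by (metis add_increasing2 linorder_le_cases not_le zero_less_one zless_add1_eq)
  then show ?thesis by (simp add: nextpt_def Let_def J_def)
qed

section \<open>The invariant of the walk, its preservation and the bounds it implies\<close>

locale hyperbola_walk =
  fixes n :: real and L :: "point set" and p :: point
  assumes n_pos: "n > 0" and p_hyp: "p \<in> hyp n"
    and comb: "\<And>u w a b. u \<in> L \<Longrightarrow> w \<in> L \<Longrightarrow> of_int a *\<^sub>R u + of_int b *\<^sub>R w \<in> L"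
begin

text \<open>
  No feasible lattice vector pointing to the right lies at or below the direction \<open>w\<close>, so the
  vector of least slope lies in the cone spanned by \<open>w\<close> and \<open>u\<close>. The vector \<open>u\<^sub>0\<close> is the initial
  value of \<open>u\<close>.
\<close>

definition enclosing :: "real \<Rightarrow> point \<Rightarrow> point \<Rightarrow> point \<Rightarrow> bool" where
  "enclosing D u0 u w \<longleftrightarrow>
     spans L u w \<and> fst u > 0 \<and> fst w \<ge> 0 \<and> snd w < 0 \<and> D > 0 \<and> cross w u = D \<and>
     p + u \<in> hyp n \<and> p + w \<notin> hyp n \<and> p + u + w \<notin> hyp n \<and>
     fst u0 > 0 \<and> fst u0 \<le> fst u \<and> cross u0 u \<le> 0 \<and>
     (\<forall>a b :: int. a \<le> 0 \<longrightarrow> b \<ge> 1 \<longrightarrow> fst (of_int a *\<^sub>R u + of_int b *\<^sub>R w) \<ge> 0 \<longrightarrow>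
        p + (of_int a *\<^sub>R u + of_int b *\<^sub>R w) \<notin> hyp n)"

lemma enclosing_below:
  assumes "enclosing D u0 u w" "v = of_int a *\<^sub>R u + of_int b *\<^sub>R w" "b \<ge> 1"
    and "fst v \<ge> 0" "p + v \<in> hyp n"
  shows "a \<ge> 1"
proof (rule ccontr)
  assume "\<not> a \<ge> 1"
  then have "a \<le> 0" by simp
  then show False using assms unfolding enclosing_def by blast
qed

lemma no_feasible_below:
  assumes enc: "enclosing D u0 u w" and line: "\<And>j :: nat. p + w + of_nat j *\<^sub>R u \<notin> hyp n"
  shows "minsl n L p = u"
proof (rule minsl_eqI[where w = w])
  have D: "cross w u > 0" and u: "fst u > 0" "u \<in> L" "p + u \<in> hyp n" and sp: "spans L u w"
    using enc by (auto simp: enclosing_def spans_def)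
  show "spans L u w" by (fact sp)
  show "cross u w \<noteq> 0" using D by (subst cross_commute) simp
  show "u \<in> steps_right n L p" using u by (auto simp: steps_right_iff)
  show "fst u > 0 \<or> fst u = 0 \<and> snd u < 0" using u by simp
  fix v assume v: "v \<in> steps_right n L p"
  obtain a b :: int where ab: "v = of_int a *\<^sub>R u + of_int b *\<^sub>R w"
    using v sp by (auto simp: spans_def steps_right_iff)
  \<comment> \<open>A positive \<open>b\<close> would put the feasible \<open>v\<close> strictly
    below \<open>u\<close>. The invariant then forces \<open>a \<ge> 1\<close>, and convexity yields
    a feasible \<open>w + c u\<close> with \<open>c \<ge> 0\<close>, against
    \<open>line\<close>.\<close>
  have "b \<le> 0"
  proof (rule ccontr)
    assume "\<not> b \<le> 0"
    then have b: "b \<ge> 1" by simp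
    have a: "a \<ge> 1" using enclosing_below[OF enc ab b] v by (simp add: steps_right_iff)
    have "p + of_int a *\<^sub>R u + of_int b *\<^sub>R w \<in> hyp n"
      using v by (simp add: steps_right_iff ab add.assoc)
    from hyp_lattice_line[OF _ p_hyp u(3) this b] n_pos
    obtain c :: int where c: "a \<le> b * c" "p + w + of_int c *\<^sub>R u \<in> hyp n" by auto
    have "c \<ge> 0"
    proof (rule ccontr)
      assume "\<not> c \<ge> 0"
      then have "b * c \<le> 0" using b by (simp add: mult_nonneg_nonpos)
      then show False using a c by simp
    qed
    then show False using line[of "nat c"] c(2) by simp
  qed
  then have "0 \<le> - (of_int b * cross w u)" using D by (simp add: mult_nonpos_nonneg)
  also have "\<dots> = cross u v" by (simp add: ab cross_commute[of u w])
  finally show "cross u v \<ge> 0" .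
qed

lemma enclosing_step:
  fixes a k :: nat
  assumes enc: "enclosing D u0 u w"
    and line: "\<And>j. j \<le> a \<Longrightarrow> p + w + of_nat j *\<^sub>R u \<notin> hyp n"
    and w': "w' = w + of_nat a *\<^sub>R u" and u': "u' = u + of_nat (Suc k) *\<^sub>R w'"
    and reach: "p + u + w' \<in> hyp n"
    and last: "p + u' \<in> hyp n" "p + u' + w' \<notin> hyp n"
  shows "enclosing D u0 u' w'" and "fst u' \<ge> fst u * (1 + of_nat a * of_nat (Suc k))"
    and "a \<ge> 1"
proof -
  have sp: "spans L u w" and fu: "fst u > 0" "fst w \<ge> 0" and u: "p + u \<in> hyp n" "p + u + w \<notin> hyp n"
    and D: "D > 0" "cross w u = D"
    and u0: "fst u0 > 0" "fst u0 \<le> fst u" "cross u0 u \<le> 0"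
    and below: "\<And>a b :: int. a \<le> 0 \<Longrightarrow> b \<ge> 1 \<Longrightarrow> fst (of_int a *\<^sub>R u + of_int b *\<^sub>R w) \<ge> 0 \<Longrightarrow>
        p + (of_int a *\<^sub>R u + of_int b *\<^sub>R w) \<notin> hyp n"
    using enc by (auto simp: enclosing_def)
  \<comment> \<open>For \<open>a = 0\<close> the vector \<open>u + w'\<close> is
    \<open>u + w\<close>, which the invariant keeps infeasible.\<close>
  show "a \<ge> 1"
  proof (rule ccontr)
    assume "\<not> a \<ge> 1"
    then have "a = 0" by simp
    then show False using reach u w' by simp
  qed
  have "fst w' \<ge> of_nat a * fst u" using fu w' by simp
  then have "of_nat (Suc k) * fst w' \<ge> of_nat (Suc k) * (of_nat a * fst u)"
    by (rule mult_left_mono) simp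
  then show grow: "fst u' \<ge> fst u * (1 + of_nat a * of_nat (Suc k))"
    by (simp add: u' algebra_simps)
  have fu': "fst u' \<ge> fst u" using fu by (simp add: u' w')
  have fw': "fst w' \<ge> 0" using fu by (simp add: w')
  have w'out: "p + w' \<notin> hyp n" using line[of a] by (simp add: w' add.assoc)
  have sw': "snd w' < 0"
  proof (rule ccontr)
    assume "\<not> snd w' < 0"
    then show False using w'out hyp_add_nonneg[OF n_pos p_hyp fw'] by simp
  qed
  \<comment> \<open>Both replacements are shears, so the determinant does not change.\<close>
  have cr: "cross w' u' = D" using D by (simp add: u' w')
  have mem: "u \<in> L" "w \<in> L" using sp by (simp_all add: spans_def)
  have w'L: "w' \<in> L" using comb[OF mem, of "int a" 1] by (simp add: w' add.commute)
  have u'L: "u' \<in> L" using comb[OF mem(1) w'L, of 1 "int (Suc k)"] by (simp add: u')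
  have sp': "spans L u' w'"
    unfolding spans_def
  proof (intro conjI ballI u'L w'L)
    fix v assume "v \<in> L"
    then obtain c d :: int where v: "v = of_int c *\<^sub>R u + of_int d *\<^sub>R w"
      using sp by (auto simp: spans_def)
    \<comment> \<open>Coefficient of \<open>u'\<close> obtained by undoing the two shears.\<close>
    define c' where "c' = c - int a * d"
    have "v = of_int c' *\<^sub>R u' + of_int (d - int (Suc k) * c') *\<^sub>R w'"
      by (simp add: v u' w' c'_def algebra_simps)
    then show "\<exists>a b. v = of_int a *\<^sub>R u' + of_int b *\<^sub>R w'" by blast
  qed
  have "cross u u' = - (of_nat (Suc k) * D)"
    using D by (simp add: u' w' cross_commute[of u w])
  then have "cross u u' \<le> 0" using D by simp
  then have slope: "cross u0 u' \<le> 0"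
    using cross_nonpos_trans[OF u0(3) _ u0(1) fu(1)] fu fu' by simp
  \<comment> \<open>A violation is rewritten first over \<open>u, w'\<close>, then over
    \<open>u, w\<close>. If its \<open>u\<close>-coordinate \<open>e\<close> is nonpositive, the old
    invariant refutes it; otherwise convexity produces a feasible \<open>w + j u\<close> with
    \<open>0 \<le> j \<le> a\<close>, which \<open>line\<close> excludes.\<close>
  have below': "p + (of_int c *\<^sub>R u' + of_int d *\<^sub>R w') \<notin> hyp n"
    if cd: "c \<le> 0" "d \<ge> 1" and right: "fst (of_int c *\<^sub>R u' + of_int d *\<^sub>R w') \<ge> 0" for c d :: int
  proof
    assume hyp: "p + (of_int c *\<^sub>R u' + of_int d *\<^sub>R w') \<in> hyp n"
    define b where "b = d + int (Suc k) * c"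
    define e where "e = c + int a * b"
    have eq: "of_int c *\<^sub>R u' + of_int d *\<^sub>R w' = of_int c *\<^sub>R u + of_int b *\<^sub>R w'"
      by (simp add: u' b_def algebra_simps)
    \<comment> \<open>If \<open>b \<le> 0\<close>, then \<open>c\<close> is negative and the vector
      would point left.\<close>
    have b: "b \<ge> 1"
    proof (rule ccontr)
      assume nb: "\<not> b \<ge> 1"
      then have "c \<noteq> 0" using cd by (auto simp: b_def)
      then have "of_int c * fst u < 0" using cd fu by (simp add: mult_neg_pos)
      moreover have "of_int b * fst w' \<le> 0" using nb fw' by (simp add: mult_nonpos_nonneg)
      ultimately show False using right unfolding eq by simp
    qed
    have eq2: "of_int c *\<^sub>R u' + of_int d *\<^sub>R w' = of_int e *\<^sub>R u + of_int b *\<^sub>R w"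
      unfolding eq by (simp add: w' e_def algebra_simps)
    show False
    proof (cases "e \<le> 0")
      case True
      then show False using below[OF True b] right hyp unfolding eq2 by simp
    next
      case False
      have "p + of_int e *\<^sub>R u + of_int b *\<^sub>R w \<in> hyp n"
        using hyp unfolding eq2 by (simp add: add.assoc)
      from hyp_lattice_line[OF _ p_hyp u(1) this b] n_pos
      obtain j :: int where j: "e \<le> b * j" "b * j < e + b" "p + w + of_int j *\<^sub>R u \<in> hyp n" by auto
      have "j \<ge> 0"
      proof (rule ccontr)
        assume "\<not> j \<ge> 0"
        then have "b * j \<le> 0" using b by (simp add: mult_nonneg_nonpos)
        then show False using False j by simp
      qed
      \<comment> \<open>From \<open>c \<le> 0\<close> one gets
        \<open>e + b \<le> b * (a + 1)\<close>; the strictness of the bound on \<open>b * j\<close>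
        is what rules out \<open>j = a + 1\<close>.\<close>
      have "b * j < b * (int a + 1)" using j(2) cd(1) by (simp add: e_def algebra_simps)
      then have "j \<le> int a" using b by (simp add: mult_less_cancel_left)
      then show False using line[of "nat j"] j(3) \<open>j \<ge> 0\<close> by (auto simp: nat_le_iff)
    qed
  qed
  show "enclosing D u0 u' w'"
    unfolding enclosing_def
    using sp' fu fu' fw' sw' D cr last w'out u0 slope below' by auto
qed

text \<open>One feasible descending \<open>v\<close> caps the width of every \<open>u\<close> the
  walk can reach. If \<open>v\<close> lies below \<open>u\<close>, then both of its coefficients are
  positive and \<open>fst u \<le> fst v\<close>; otherwise compare slopes. In both cases no feasible
  vector descends further than \<open>snd p\<close>.\<close>

lemma enclosing_bound_of_descent:
  assumes enc: "enclosing D u0 u w" and v: "v \<in> L" "fst v \<ge> 0" "snd v < 0" "p + v \<in> hyp n"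
  shows "fst u * (- snd v) \<le> snd p * fst v"
proof -
  have u: "fst u > 0" "fst w \<ge> 0" "p + u \<in> hyp n" "D > 0" "cross w u = D"
    using enc by (auto simp: enclosing_def)
  obtain a b :: int where ab: "v = of_int a *\<^sub>R u + of_int b *\<^sub>R w"
    using enc v by (auto simp: enclosing_def spans_def)
  have sv: "- snd v \<le> snd p" "- snd u \<le> snd p"
    using hyp_pos(2)[OF n_pos v(4)] hyp_pos(2)[OF n_pos u(3)] by simp_all
  show ?thesis
  proof (cases "b \<ge> 1")
    case True
    have a: "a \<ge> 1" using enclosing_below[OF enc ab True] v by simp
    have "1 * fst u \<le> of_int a * fst u" using a u by (intro mult_right_mono) auto
    moreover have "0 \<le> of_int b * fst w" using True u by simp
    ultimately have "fst u \<le> fst v" by (simp add: ab)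
    then have "fst u * (- snd v) \<le> fst v * snd p" using sv v u by (intro mult_mono) auto
    then show ?thesis by (simp add: mult.commute)
  next
    case False
    then have "0 \<le> - (of_int b * D)" using u by (simp add: mult_nonpos_nonneg)
    also have "\<dots> = cross u v" using u by (simp add: ab cross_commute[of u w])
    finally have "fst u * (- snd v) \<le> (- snd u) * fst v" by (simp add: cross_def)
    also have "\<dots> \<le> snd p * fst v" using sv v by (intro mult_right_mono) auto
    finally show ?thesis .
  qed
qed

text \<open>If \<open>u\<close> does not descend, then \<open>D\<close> is a sum of two nonnegative
  terms, one of which is \<open>fst u * (- snd w)\<close>.\<close>

lemma enclosing_bound_of_flat:
  assumes enc: "enclosing D u0 u w" and "snd u \<ge> 0" "h \<le> - snd w"
  shows "fst u * h \<le> D"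
proof -
  have u: "fst u > 0" "fst w \<ge> 0" "cross w u = D" using enc by (auto simp: enclosing_def)
  have "fst u * h \<le> fst u * (- snd w)" using u assms by (intro mult_left_mono) auto
  also have "\<dots> \<le> fst w * snd u + fst u * (- snd w)" using u assms by simp
  also have "\<dots> = D" using u by (simp add: cross_def algebra_simps)
  finally show ?thesis .
qed

end

section \<open>Running times of programs\<close>

text \<open>Total correctness with a cost budget, real-valued so that logarithms fit in.\<close>

definition runs :: "com \<Rightarrow> state \<Rightarrow> real \<Rightarrow> (state \<Rightarrow> bool) \<Rightarrow> bool" where
  "runs c s T Q \<longleftrightarrow> (\<exists>t s'. exec c s t s' \<and> real t \<le> T \<and> Q s')"

lemma runs_mono:
  assumes "runs c s T Q" "T \<le> T'" "\<And>s'. Q s' \<Longrightarrow> Q' s'"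
  shows "runs c s T' Q'"
  using assms unfolding runs_def by (meson order_trans)

lemma runs_Skip: "Q s \<Longrightarrow> T \<ge> 0 \<Longrightarrow> runs Skip s T Q"
  unfolding runs_def using exec.Skip by fastforce

lemma runs_Assign: "Q (s(x := aval a s)) \<Longrightarrow> real (acost a) \<le> T \<Longrightarrow> runs (Assign x a) s T Q"
  unfolding runs_def using exec.Assign by blast

lemma runs_Seq:
  assumes "runs c1 s T1 R" "\<And>s'. R s' \<Longrightarrow> runs c2 s' T2 Q"
  shows "runs (Seq c1 c2) s (T1 + T2) Q"
proof -
  obtain t1 s1 where 1: "exec c1 s t1 s1" "real t1 \<le> T1" "R s1"
    using assms(1) by (auto simp: runs_def)
  obtain t2 s2 where 2: "exec c2 s1 t2 s2" "real t2 \<le> T2" "Q s2"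
    using assms(2)[OF 1(3)] by (auto simp: runs_def)
  show ?thesis
    unfolding runs_def using exec.Seq[OF 1(1) 2(1)] 1 2 by (intro exI[of _ "t1 + t2"] exI[of _ s2]) auto
qed

text \<open>The cost is taken off the budget instead of added to it, so straight-line code unrolls
  by backward application.\<close>

lemma runs_Assign_Seq:
  "runs c (s(x := aval a s)) (T - real (acost a)) Q \<Longrightarrow> runs (Seq (Assign x a) c) s T Q"
  using runs_Seq[OF runs_Assign[of "\<lambda>s'. s' = s(x := aval a s)" s x a "acost a"],
      of c "T - real (acost a)" Q] by simp

lemma runs_Cond:
  assumes "bval b s \<Longrightarrow> runs c1 s (T - real (bcost b)) Q" "\<not> bval b s \<Longrightarrow> runs c2 s (T - real (bcost b)) Q"
  shows "runs (Cond b c1 c2) s T Q"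
proof (cases "bval b s")
  case True
  then obtain t s' where "exec c1 s t s'" "real t \<le> T - real (bcost b)" "Q s'"
    using assms(1) by (auto simp: runs_def)
  then show ?thesis
    unfolding runs_def using exec.CondTrue[OF True] by (intro exI[of _ "bcost b + t"] exI[of _ s']) auto
next
  case False
  then obtain t s' where "exec c2 s t s'" "real t \<le> T - real (bcost b)" "Q s'"
    using assms(2) by (auto simp: runs_def)
  then show ?thesis
    unfolding runs_def using exec.CondFalse[OF False] by (intro exI[of _ "bcost b + t"] exI[of _ s']) auto
qed

lemma runs_While_exit: "\<not> bval b s \<Longrightarrow> Q s \<Longrightarrow> real (bcost b) \<le> T \<Longrightarrow> runs (While b c) s T Q"
  unfolding runs_def using exec.WhileFalse by blast

lemma runs_While_step:
  assumes "bval b s" "runs c s T1 R" "\<And>s'. R s' \<Longrightarrow> runs (While b c) s' T2 Q"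
  shows "runs (While b c) s (real (bcost b) + T1 + T2) Q"
proof -
  obtain t1 s1 where 1: "exec c s t1 s1" "real t1 \<le> T1" "R s1"
    using assms(2) by (auto simp: runs_def)
  obtain t2 s2 where 2: "exec (While b c) s1 t2 s2" "real t2 \<le> T2" "Q s2"
    using assms(3)[OF 1(3)] by (auto simp: runs_def)
  show ?thesis
    unfolding runs_def using exec.WhileTrue[OF assms(1) 1(1) 2(1)] 1 2
    by (intro exI[of _ "bcost b + t1 + t2"] exI[of _ s2]) auto
qed

text \<open>
  Search for the largest natural number satisfying a downward closed test \<open>B\<close> of variable \<open>8\<close>, by
  doubling and then bisection. The result is left in variable \<open>9\<close>.
\<close>

definition doubling :: "bexp \<Rightarrow> com" where
  "doubling B = While B (Seq (Assign 10 (Mul (Const 2) (Var 10))) (Assign 8 (Var 10)))"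

definition bisection :: "bexp \<Rightarrow> com" where
  "bisection B = While (Less (Const 1) (Var 10))
     (Seq (Assign 10 (IDiv (Var 10) (Const 2)))
     (Seq (Assign 8 (Add (Var 9) (Var 10)))
     (Cond B (Assign 9 (Var 8)) Skip)))"

definition gallop :: "bexp \<Rightarrow> com" where
  "gallop B = Seq (Assign 9 (Const 0)) (Seq (Assign 10 (Const 1)) (Seq (Assign 8 (Const 1))
     (Seq (doubling B) (bisection B))))"

text \<open>Variables \<open>8\<close>, \<open>9\<close>, \<open>10\<close> are the scratch space of
  \<open>gallop\<close>.\<close>

definition agree :: "state \<Rightarrow> state \<Rightarrow> bool" where
  "agree s s' \<longleftrightarrow> (\<forall>i. i \<notin> {8, 9, 10} \<longrightarrow> s' i = s i)"

text \<open>The test may read variable \<open>8\<close> but must be insensitive to \<open>9\<close>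
  and \<open>10\<close>.\<close>

definition tests :: "bexp \<Rightarrow> state \<Rightarrow> (nat \<Rightarrow> bool) \<Rightarrow> bool" where
  "tests B s P \<longleftrightarrow> (\<forall>s' k. agree s s' \<longrightarrow> s' 8 = real k \<longrightarrow> (bval B s' \<longleftrightarrow> P k))"

lemma testsD: "tests B s P \<Longrightarrow> agree s s' \<Longrightarrow> s' 8 = real k \<Longrightarrow> bval B s' \<longleftrightarrow> P k"
  by (simp add: tests_def)

text \<open>\<open>i\<close> counts the doublings done and \<open>d\<close> those left.
  \<open>P\<close> is described from \<open>1\<close> on because position \<open>0\<close> is never
  tested.\<close>

lemma runs_doubling:
  assumes B: "tests B s P" and P: "\<And>k. k \<ge> 1 \<Longrightarrow> P k \<longleftrightarrow> k \<le> K"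
    and m: "K < 2 ^ m" "\<And>i. i < m \<Longrightarrow> 2 ^ i \<le> K"
  shows "agree s s1 \<Longrightarrow> s1 8 = 2 ^ i \<Longrightarrow> s1 9 = 0 \<Longrightarrow> s1 10 = 2 ^ i \<Longrightarrow> i + d = m \<Longrightarrow>
    runs (doubling B) s1 (d * (bcost B + 1) + bcost B)
      (\<lambda>s'. agree s s' \<and> s' 9 = 0 \<and> s' 10 = 2 ^ m)"
proof (induction d arbitrary: i s1)
  case 0
  have "bval B s1 \<longleftrightarrow> P (2 ^ i)" using testsD[OF B] 0 by simp
  then have "\<not> bval B s1" using P[of "2 ^ i"] m(1) 0 by simp
  then show ?case unfolding doubling_def using 0 by (intro runs_While_exit) auto
next
  case (Suc d)
  have "bval B s1 \<longleftrightarrow> P (2 ^ i)" using testsD[OF B] Suc.prems by simp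
  then have go: "bval B s1" using P[of "2 ^ i"] m(2)[of i] Suc.prems by simp
  have "runs (doubling B) s1 (real (bcost B) + 1 + real (d * (bcost B + 1) + bcost B))
      (\<lambda>s'. agree s s' \<and> s' 9 = 0 \<and> s' 10 = 2 ^ m)"
    unfolding doubling_def
  proof (rule runs_While_step[OF go])
    show "runs (Seq (Assign 10 (Mul (Const 2) (Var 10))) (Assign 8 (Var 10))) s1 1
        (\<lambda>s'. agree s s' \<and> s' 8 = 2 ^ Suc i \<and> s' 9 = 0 \<and> s' 10 = 2 ^ Suc i)"
      using Suc.prems by (intro runs_Assign_Seq runs_Assign) (auto simp: agree_def)
    fix s' assume s': "agree s s' \<and> s' 8 = 2 ^ Suc i \<and> s' 9 = 0 \<and> s' 10 = 2 ^ Suc i"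
    show "runs (While B (Seq (Assign 10 (Mul (Const 2) (Var 10))) (Assign 8 (Var 10)))) s'
        (d * (bcost B + 1) + bcost B) (\<lambda>s'. agree s s' \<and> s' 9 = 0 \<and> s' 10 = 2 ^ m)"
      using Suc.IH[of s' "Suc i"] s' Suc.prems by (simp add: doubling_def)
  qed
  then show ?case by (rule runs_mono) (auto simp: algebra_simps)
qed

text \<open>The loop invariant is that \<open>K\<close> lies in the window of length
  \<open>2 ^ m\<close> starting at variable \<open>9\<close>.\<close>

lemma runs_bisection:
  assumes B: "tests B s P" and P: "\<And>k. k \<ge> 1 \<Longrightarrow> P k \<longleftrightarrow> k \<le> K"
  shows "agree s s1 \<Longrightarrow> s1 9 = real c \<Longrightarrow> s1 10 = 2 ^ m \<Longrightarrow> c \<le> K \<Longrightarrow> K < c + 2 ^ m \<Longrightarrow>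
    runs (bisection B) s1 (m * (bcost B + 3) + 1) (\<lambda>s'. agree s s' \<and> s' 9 = real K)"
proof (induction m arbitrary: c s1)
  case 0
  then show ?case unfolding bisection_def by (intro runs_While_exit) auto
next
  case (Suc m)
  have "1 < (2 :: real) ^ Suc m" by (rule one_less_power) auto
  then have go: "bval (Less (Const 1) (Var 10)) s1" using Suc.prems by simp
  have "runs (bisection B) s1
      (real (bcost (Less (Const 1) (Var 10))) + (2 + real (bcost B)) + real (m * (bcost B + 3) + 1))
      (\<lambda>s'. agree s s' \<and> s' 9 = real K)"
    unfolding bisection_def
  proof (rule runs_While_step[OF go])
    define s2 where "s2 = (s1(10 := 2 ^ m))(8 := real (c + 2 ^ m))"
    \<comment> \<open>The window length is a power of two, so integer division halves it
      exactly.\<close>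
    have half: "real_of_int \<lfloor>(2 :: real) ^ Suc m / 2\<rfloor> = 2 ^ m"
      using floor_of_int[of "2 ^ m", where ?'a = real] by simp
    have s2: "agree s s2" "s2 8 = real (c + 2 ^ m)" "s2 9 = real c" "s2 10 = 2 ^ m"
      using Suc.prems by (auto simp: s2_def agree_def)
    have val: "bval B s2 \<longleftrightarrow> c + 2 ^ m \<le> K" 
      using testsD[OF B s2(1,2)] P[of "c + 2 ^ m"] one_le_power[of "2 :: nat" m] by linarith
    have "runs (Cond B (Assign 9 (Var 8)) Skip) s2 (bcost B)
        (\<lambda>s'. \<exists>c. agree s s' \<and> s' 9 = real c \<and> s' 10 = 2 ^ m \<and> c \<le> K \<and> K < c + 2 ^ m)"
    proof (intro runs_Cond runs_Assign runs_Skip)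
      assume "bval B s2"
      then show "\<exists>c. agree s (s2(9 := aval (Var 8) s2)) \<and> (s2(9 := aval (Var 8) s2)) 9 = real c \<and>
          (s2(9 := aval (Var 8) s2)) 10 = 2 ^ m \<and> c \<le> K \<and> K < c + 2 ^ m"
        using s2 val Suc.prems by (intro exI[of _ "c + 2 ^ m"]) (auto simp: agree_def)
    next
      assume "\<not> bval B s2"
      then show "\<exists>c. agree s s2 \<and> s2 9 = real c \<and> s2 10 = 2 ^ m \<and> c \<le> K \<and> K < c + 2 ^ m"
        using s2 val Suc.prems by (intro exI[of _ c]) auto
    qed auto
    then show "runs (Seq (Assign 10 (IDiv (Var 10) (Const 2)))
        (Seq (Assign 8 (Add (Var 9) (Var 10))) (Cond B (Assign 9 (Var 8)) Skip))) s1 (2 + real (bcost B))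
        (\<lambda>s'. \<exists>c. agree s s' \<and> s' 9 = real c \<and> s' 10 = 2 ^ m \<and> c \<le> K \<and> K < c + 2 ^ m)"
      using Suc.prems half by (intro runs_Assign_Seq) (simp add: s2_def)
    fix s' assume "\<exists>c. agree s s' \<and> s' 9 = real c \<and> s' 10 = 2 ^ m \<and> c \<le> K \<and> K < c + 2 ^ m"
    then show "runs (While (Less (Const 1) (Var 10)) (Seq (Assign 10 (IDiv (Var 10) (Const 2)))
        (Seq (Assign 8 (Add (Var 9) (Var 10))) (Cond B (Assign 9 (Var 8)) Skip)))) s'
        (m * (bcost B + 3) + 1) (\<lambda>s'. agree s s' \<and> s' 9 = real K)"
      using Suc.IH by (auto simp: bisection_def)
  qed
  then show ?case by (rule runs_mono) (auto simp: algebra_simps)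
qed

lemma runs_gallop:
  assumes B: "tests B s P" and P: "\<And>k. k \<ge> 1 \<Longrightarrow> P k \<longleftrightarrow> k \<le> K"
  shows "runs (gallop B) s (real (2 * bcost B + 5) * (2 + log 2 (1 + K)))
    (\<lambda>s'. agree s s' \<and> s' 9 = real K)"
proof -
  define m where "m = (LEAST m. K < 2 ^ m)"
  have m: "K < 2 ^ m" unfolding m_def by (rule LeastI[of _ K]) simp
  have below: "2 ^ i \<le> K" if "i < m" for i
    using not_less_Least[of i "\<lambda>m. K < 2 ^ m"] that by (simp add: m_def)
  have logm: "m \<le> 1 + log 2 (1 + K)"
  proof (cases m)
    case 0
    then show ?thesis by (simp add: add_nonneg_nonneg)
  next
    case (Suc i)
    then have "real (2 ^ i) \<le> real K" using below[of i] by (simp only: of_nat_le_iff)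
    then have "(2 :: real) ^ i \<le> real K" by (simp only: of_nat_power of_nat_numeral)
    then have "(2 :: real) ^ i \<le> 1 + real K" by linarith
    then have "i \<le> log 2 (1 + K)" by (subst le_log_iff) (auto simp: powr_realpow)
    then show ?thesis using Suc by simp
  qed
  define s1 where "s1 = (s(9 := 0, 10 := 1, 8 := 1) :: state)"
  have s1: "agree s s1" "s1 8 = 2 ^ 0" "s1 9 = 0" "s1 10 = 2 ^ 0" "0 + m = m"
    by (auto simp: s1_def agree_def)
  have "runs (Seq (doubling B) (bisection B)) s1
      (real (m * (bcost B + 1) + bcost B) + real (m * (bcost B + 3) + 1))
      (\<lambda>s'. agree s s' \<and> s' 9 = real K)"
  proof (rule runs_Seq)
    show "runs (doubling B) s1 (m * (bcost B + 1) + bcost B)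
        (\<lambda>s'. agree s s' \<and> s' 9 = 0 \<and> s' 10 = 2 ^ m)"
      using runs_doubling[OF B P m below s1] by auto
    show "runs (bisection B) s' (m * (bcost B + 3) + 1) (\<lambda>s'. agree s s' \<and> s' 9 = real K)"
      if "agree s s' \<and> s' 9 = 0 \<and> s' 10 = 2 ^ m" for s'
      using runs_bisection[OF B P, of s' 0 m] that m by simp
  qed
  \<comment> \<open>The three initial assignments of constants cost nothing.\<close>
  then have "runs (gallop B) s (real (m * (bcost B + 1) + bcost B) + real (m * (bcost B + 3) + 1))
      (\<lambda>s'. agree s s' \<and> s' 9 = real K)"
    unfolding gallop_def by (intro runs_Assign_Seq) (simp add: s1_def)
  moreover have "real (m * (bcost B + 1) + bcost B) + real (m * (bcost B + 3) + 1)
      \<le> real (2 * bcost B + 5) * (2 + log 2 (1 + K))"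
  proof -
    have "real (m * (bcost B + 1) + bcost B) + real (m * (bcost B + 3) + 1)
        \<le> real (2 * bcost B + 5) * (real m + 1)" by (simp add: algebra_simps)
    also have "\<dots> \<le> real (2 * bcost B + 5) * (2 + log 2 (1 + K))"
      using logm by (intro mult_left_mono) auto
    finally show ?thesis .
  qed
  ultimately show ?thesis by (rule runs_mono) auto
qed

section \<open>Searching along a line\<close>

lemma initial_segmentE:
  fixes P :: "nat \<Rightarrow> bool"
  assumes down: "\<And>j k. 1 \<le> j \<Longrightarrow> j \<le> k \<Longrightarrow> P k \<Longrightarrow> P j" and "\<exists>k\<ge>1. \<not> P k"
  obtains K where "\<And>k. k \<ge> 1 \<Longrightarrow> P k \<longleftrightarrow> k \<le> K"
proof -
  define m where "m = (LEAST k. k \<ge> 1 \<and> \<not> P k)"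
  have m: "m \<ge> 1" "\<not> P m" using LeastI_ex[of "\<lambda>k. k \<ge> 1 \<and> \<not> P k"] assms(2) by (auto simp: m_def)
  have "P k \<longleftrightarrow> k \<le> m - 1" if "k \<ge> 1" for k
  proof
    assume "P k"
    then have "\<not> m \<le> k" using down[OF m(1)] m(2) by blast
    then show "k \<le> m - 1" by simp
  next
    assume "k \<le> m - 1"
    then have "k < m" using m(1) by simp
    then show "P k" using not_less_Least[of k "\<lambda>k. k \<ge> 1 \<and> \<not> P k"] that by (auto simp: m_def)
  qed
  then show thesis by (rule that)
qed

lemma exists_multiple_above:
  fixes c d :: real
  assumes "d > 0"
  shows "\<exists>k :: nat. k \<ge> 1 \<and> c \<le> k * d"
proof -
  obtain k :: nat where "c / d \<le> k" using real_arch_simple by blast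
  then have "c \<le> k * d" using assms by (simp add: field_simps)
  also have "\<dots> \<le> Suc k * d" using assms by simp
  finally show ?thesis by (intro exI[of _ "Suc k"]) auto
qed

text \<open>
  The test \<open>approaching\<close> stays true along \<open>(X, Y) + k (a, b)\<close> as long as the hyperbola has not been
  reached and still can be: if \<open>b \<le> 0\<close>, then the product of the coordinates is concave in \<open>k\<close>, and
  \<open>a y + b x\<close> is its derivative.
\<close>

definition approaching :: "real \<Rightarrow> real \<Rightarrow> real \<Rightarrow> real \<Rightarrow> real \<Rightarrow> nat \<Rightarrow> bool" where
  "approaching n X Y a b k \<longleftrightarrow> (X + k * a) * (Y + k * b) < n \<and>
     (0 < b \<or> 0 < a * (Y + k * b) + b * (X + k * a))"

text \<open>Once the test fails short of the hyperbola, the product has stopped increasing, so the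
  line never arrives. In that case the test still held at a positive \<open>K\<close>, which forces
  the second coordinate there to be positive and thus bounds \<open>K\<close>.\<close>

lemma approaching_search:
  fixes n X Y a b :: real
  assumes n: "n > 0" and X: "X > 0" and a: "a > 0" and out: "X * Y < n"
  obtains K where "\<And>k. k \<ge> 1 \<Longrightarrow> approaching n X Y a b k \<longleftrightarrow> k \<le> K"
    and "\<And>j :: nat. j \<le> K \<Longrightarrow> (X + j * a) * (Y + j * b) < n"
    and "\<And>j :: nat. (X + Suc K * a) * (Y + Suc K * b) < n \<Longrightarrow> (X + j * a) * (Y + j * b) < n"
    and "(X + Suc K * a) * (Y + Suc K * b) < n \<Longrightarrow> K \<ge> 1 \<Longrightarrow> b < 0 \<and> K * (- b) \<le> Y"
proof -
  let ?x = "\<lambda>k :: nat. X + k * a" and ?y = "\<lambda>k :: nat. Y + k * b"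
  have xpos: "?x k > 0" for k using X a by (simp add: add_pos_nonneg)
  have down: "approaching n X Y a b j" if jk: "1 \<le> j" "j \<le> k" and k: "approaching n X Y a b k" for j k
  proof (cases "0 < b")
    case True
    have "?x j * ?y j < n"
    proof (rule ccontr)
      assume "\<not> ?x j * ?y j < n"
      then have ge: "n \<le> ?x j * ?y j" by simp
      then have "?y j > 0" 
        using zero_less_mult_pos[of "?x j" "?y j"] n xpos[of j] by linarith
      moreover have "?x j \<le> ?x k" "?y j \<le> ?y k" using jk a True by (simp_all add: mult_right_mono)
      ultimately have "?x j * ?y j \<le> ?x k * ?y k" using xpos by (intro mult_mono) (auto simp: less_imp_le)
      then show False using ge k by (simp add: approaching_def)
    qed
    then show ?thesis using True by (simp add: approaching_def)
  next
    case False
    define t where "t = real k - real j"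
    have t: "t \<ge> 0" using jk by (simp add: t_def)
    have eq: "?x j = ?x k - t * a" "?y j = ?y k - t * b" by (simp_all add: t_def algebra_simps)
    have rise: "0 < a * ?y k + b * ?x k" and below: "?x k * ?y k < n"
      using k False by (simp_all add: approaching_def)
    have ab: "a * b \<le> 0" using a False by (simp add: mult_nonneg_nonpos)
    have "a * ?y j + b * ?x j = a * ?y k + b * ?x k - 2 * (t * (a * b))"
      unfolding eq by (simp add: algebra_simps)
    moreover have "t * (a * b) \<le> 0" using t ab by (simp add: mult_nonneg_nonpos)
    ultimately have "0 < a * ?y j + b * ?x j" using rise by linarith
    \<comment> \<open>Exact expansion of the quadratic about \<open>k\<close>, going back by
      \<open>t\<close>; both correction terms lower the value.\<close>
    moreover have "?x j * ?y j = ?x k * ?y k - t * (a * ?y k + b * ?x k) + t * t * (a * b)"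
      unfolding eq by (simp add: algebra_simps)
    moreover have "t * t * (a * b) \<le> 0" "0 \<le> t * (a * ?y k + b * ?x k)"
      using t ab rise by (simp_all add: mult_nonneg_nonpos)
    ultimately show ?thesis using below by (simp add: approaching_def)
  qed
  \<comment> \<open>For \<open>b < 0\<close> the derivative becomes negative once the second
    coordinate is nonpositive. For \<open>b = 0\<close> the product grows to \<open>n\<close> or the
    derivative is never positive. For \<open>b > 0\<close> the second coordinate eventually reaches
    \<open>n / X\<close>.\<close>
  have "\<exists>k\<ge>1. \<not> approaching n X Y a b k"
  proof (cases "b < 0")
    case True
    then obtain k :: nat where k: "k \<ge> 1" "Y \<le> k * (- b)" using exists_multiple_above[of "- b" Y] by auto
    then have "a * ?y k \<le> 0" using a by (simp add: mult_nonneg_nonpos)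
    moreover have "b * ?x k < 0" using True xpos[of k] by (simp add: mult_neg_pos)
    ultimately show ?thesis using True k(1) by (auto simp: approaching_def)
  next
    case False
    show ?thesis
    proof (cases "b = 0")
      case True
      show ?thesis
      proof (cases "Y > 0")
        case True
        then obtain k :: nat where k: "k \<ge> 1" "n \<le> k * (a * Y)"
          using exists_multiple_above[of "a * Y" n] a by auto
        have "k * (a * Y) \<le> ?x k * Y" using X True by (simp add: algebra_simps)
        then show ?thesis using k \<open>b = 0\<close> by (auto simp: approaching_def)
      next
        case False
        then have "\<not> 0 < a * Y" using a by (simp add: zero_less_mult_iff)
        then show ?thesis using \<open>b = 0\<close> by (auto simp: approaching_def)
      qed
    next
      case nz: False
      then have b: "b > 0" using False by simp
      then obtain k :: nat where k: "k \<ge> 1" "n / X - Y \<le> k * b"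
        using exists_multiple_above[of b "n / X - Y"] by auto
      then have "n / X \<le> ?y k" by simp
      then have "n \<le> X * ?y k" using X by (simp add: field_simps)
      moreover have "0 \<le> ?y k" 
        using \<open>n / X \<le> ?y k\<close> divide_pos_pos[OF n X] by linarith
      then have "X * ?y k \<le> ?x k * ?y k" using a by (intro mult_right_mono) auto
      ultimately show ?thesis using k(1) by (auto simp: approaching_def)
    qed
  qed
  then obtain K where K: "\<And>k. k \<ge> 1 \<Longrightarrow> approaching n X Y a b k \<longleftrightarrow> k \<le> K"
    using initial_segmentE[of "approaching n X Y a b"] down by blast
  have low: "?x j * ?y j < n" if "j \<le> K" for j
    using K[of j] that out by (cases "j = 0") (auto simp: approaching_def)
  \<comment> \<open>The hyperbola is not reached at \<open>Suc K\<close>, so the second clause of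
    the test is the one that fails.\<close>
  have fail: "b \<le> 0" "a * ?y (Suc K) + b * ?x (Suc K) \<le> 0" if "?x (Suc K) * ?y (Suc K) < n"
    using K[of "Suc K"] that by (auto simp: approaching_def)
  show thesis
  proof (rule that[OF K low])
    fix j :: nat assume S: "?x (Suc K) * ?y (Suc K) < n"
    show "?x j * ?y j < n"
    proof (cases "j \<le> K")
      case True
      then show ?thesis by (rule low)
    next
      case False
      define t where "t = real j - real (Suc K)"
      have t: "t \<ge> 0" using False by (simp add: t_def)
      have eq: "?x j = ?x (Suc K) + t * a" "?y j = ?y (Suc K) + t * b"
        by (simp_all add: t_def algebra_simps)
      have "?x j * ?y j = ?x (Suc K) * ?y (Suc K) + t * (a * ?y (Suc K) + b * ?x (Suc K)) + t * t * (a * b)"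
        unfolding eq by (simp only: algebra_simps)
      moreover have "t * (a * ?y (Suc K) + b * ?x (Suc K)) \<le> 0"
        using t fail(2)[OF S] by (rule mult_nonneg_nonpos)
      moreover have "t * t * (a * b) \<le> 0"
        using t a fail(1)[OF S] by (intro mult_nonneg_nonpos) (simp_all add: mult_nonneg_nonpos)
      ultimately show ?thesis using S by linarith
    qed
  next
    assume S: "?x (Suc K) * ?y (Suc K) < n" and "K \<ge> 1"
    then have rise: "0 < a * ?y K + b * ?x K" using K[of K] fail(1)[OF S] by (auto simp: approaching_def)
    \<comment> \<open>For \<open>b = 0\<close> the derivative is the constant \<open>a * Y\<close>,
      which cannot be positive at \<open>K\<close> and nonpositive at \<open>Suc K\<close>.\<close>
    have "b \<noteq> 0"
    proof
      assume "b = 0"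
      then show False using rise fail(2)[OF S] by simp
    qed
    then have b: "b < 0" using fail(1)[OF S] by simp
    then have "b * ?x K < 0" using xpos[of K] by (simp add: mult_neg_pos)
    then have "0 < a * ?y K" using rise by linarith
    then have "0 < ?y K" using a by (simp add: zero_less_mult_iff)
    then show "b < 0 \<and> K * (- b) \<le> Y" using b by simp
  qed
qed

text \<open>Convexity makes the feasible multiples an initial segment; positivity of the second
  coordinate inside the region makes it finite and bounds \<open>K\<close>.\<close>

lemma feasible_search:
  assumes n: "n > 0" and q: "q \<in> hyp n" and v: "fst v \<ge> 0" "snd v < 0"
  obtains K where "\<And>k :: nat. k \<ge> 1 \<Longrightarrow> n \<le> fst (q + k *\<^sub>R v) * snd (q + k *\<^sub>R v) \<longleftrightarrow> k \<le> K"
    and "q + K *\<^sub>R v \<in> hyp n" and "q + Suc K *\<^sub>R v \<notin> hyp n"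
    and "K * (- snd v) \<le> snd q"
proof -
  have mem: "n \<le> fst (q + k *\<^sub>R v) * snd (q + k *\<^sub>R v) \<longleftrightarrow> q + k *\<^sub>R v \<in> hyp n" for k :: nat
    using hyp_pos(1)[OF n q] v(1) by (intro hyp_iff[OF n, symmetric]) (simp add: add_pos_nonneg)
  obtain k :: nat where k: "k \<ge> 1" "snd q \<le> k * (- snd v)"
    using exists_multiple_above[of "- snd v" "snd q"] v by auto
  then have "\<not> 0 < snd (q + k *\<^sub>R v)" by simp
  then have "q + k *\<^sub>R v \<notin> hyp n" using hyp_pos(2)[OF n] by blast
  then have ex: "\<exists>k\<ge>1. \<not> q + real k *\<^sub>R v \<in> hyp n" using k by blast
  have "q + real j *\<^sub>R v \<in> hyp n" if "1 \<le> j" "j \<le> k" "q + real k *\<^sub>R v \<in> hyp n" for j k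
    using hyp_segment[OF _ q that(3), of "real j"] n that by simp
  then obtain K where K: "\<And>k. k \<ge> 1 \<Longrightarrow> q + real k *\<^sub>R v \<in> hyp n \<longleftrightarrow> k \<le> K"
    using initial_segmentE[of "\<lambda>k. q + real k *\<^sub>R v \<in> hyp n"] ex by blast
  have in_K: "q + K *\<^sub>R v \<in> hyp n" using K[of K] q by (cases "K = 0") auto
  show thesis
  proof (rule that)
    show "n \<le> fst (q + k *\<^sub>R v) * snd (q + k *\<^sub>R v) \<longleftrightarrow> k \<le> K" if "k \<ge> 1" for k :: nat
      unfolding mem by (rule K[OF that])
    show "q + Suc K *\<^sub>R v \<notin> hyp n" using K[of "Suc K"] by simp
    show "K * (- snd v) \<le> snd q" using hyp_pos(2)[OF n in_K] by simp
  qed (fact in_K)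
qed

section \<open>The program\<close>

text \<open>
  Variable \<open>0\<close> holds \<open>n\<close>; variables \<open>1, 2\<close> hold the point \<open>p\<close>, variables \<open>3, 4\<close> the vector \<open>u\<close> and
  variables \<open>5, 6\<close> the vector \<open>w\<close>. Variable \<open>7\<close> is set to leave the main loop.
\<close>

definition advance_test :: bexp where
  "advance_test =
     (let X = Add (Add (Var 1) (Var 5)) (Mul (Var 8) (Var 3));
          Y = Add (Add (Var 2) (Var 6)) (Mul (Var 8) (Var 4))
      in Conj (Less (Mul X Y) (Var 0))
           (Neg (Conj (Leq (Var 4) (Const 0))
             (Leq (Add (Mul (Var 3) Y) (Mul (Var 4) X)) (Const 0)))))"

definition descend_test :: bexp where
  "descend_test = Leq (Var 0)
     (Mul (Add (Add (Var 1) (Var 3)) (Mul (Var 8) (Var 5)))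
          (Add (Add (Var 2) (Var 4)) (Mul (Var 8) (Var 6))))"

definition jump_test :: bexp where
  "jump_test = Leq (Var 0)
     (Mul (Add (Var 1) (Mul (Var 8) (Var 3))) (Add (Var 2) (Mul (Var 8) (Var 4))))"

definition descend :: com where
  "descend = Seq (Assign 3 (Add (Var 3) (Var 5))) (Seq (Assign 4 (Add (Var 4) (Var 6)))
     (Seq (gallop descend_test)
     (Seq (Assign 3 (Add (Var 3) (Mul (Var 9) (Var 5)))) (Assign 4 (Add (Var 4) (Mul (Var 9) (Var 6)))))))"

text \<open>The point examined after the search is the first position where
  \<open>advance_test\<close> failed: either the hyperbola was reached there, or the line never
  reaches it.\<close>

definition narrow :: com where
  "narrow = Seq (gallop advance_test)
     (Seq (Assign 5 (Add (Var 5) (Mul (Var 9) (Var 3)))) (Seq (Assign 6 (Add (Var 6) (Mul (Var 9) (Var 4))))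
     (Cond (Leq (Var 0) (Mul (Add (Add (Var 1) (Var 3)) (Var 5)) (Add (Add (Var 2) (Var 4)) (Var 6))))
       descend (Assign 7 (Const 1)))))"

text \<open>Variable \<open>0\<close> still holds the positive \<open>n\<close>, so a finite answer
  reads as nonzero; overwriting it with \<open>0\<close> encodes \<open>\<infinity>\<close>.\<close>

definition jump :: com where
  "jump = Cond (Less (Var 4) (Const 0))
     (Seq (gallop jump_test)
     (Seq (Assign 1 (Add (Var 1) (Mul (Var 9) (Var 3)))) (Assign 2 (Add (Var 2) (Mul (Var 9) (Var 4))))))
     (Assign 0 (Const 0))"

definition search :: com where
  "search = Seq (While (Eq (Var 7) (Const 0)) narrow) jump"

text \<open>A feasible drop along \<open>- b2\<close> has slope \<open>-\<infinity>\<close> and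
  settles the answer at once. Otherwise \<open>b1\<close> is lowered as far as possible to give the
  first \<open>u\<close>, and \<open>- b2\<close> is the first \<open>w\<close>.\<close>

definition next_point :: com where
  "next_point =
     Seq (Assign 9 (IDiv (Sub (Mul (Var 1) (Var 2)) (Var 0)) (Mul (Var 1) (Var 6))))
     (Cond (Leq (Const 1) (Var 9))
       (Assign 2 (Sub (Var 2) (Mul (Var 9) (Var 6))))
       (Seq (Assign 9 (IDiv (Sub (Mul (Add (Var 1) (Var 3)) (Add (Var 2) (Var 4))) (Var 0))
                            (Mul (Add (Var 1) (Var 3)) (Var 6))))
       (Seq (Assign 4 (Sub (Var 4) (Mul (Var 9) (Var 6))))
       (Seq (Assign 6 (Sub (Const 0) (Var 6))) search))))"

section \<open>Correctness and cost of the search\<close>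

context hyperbola_walk
begin

definition holds :: "state \<Rightarrow> point \<Rightarrow> point \<Rightarrow> bool" where
  "holds s u w \<longleftrightarrow> s 0 = n \<and> s 1 = fst p \<and> s 2 = snd p \<and> s 3 = fst u \<and> s 4 = snd u \<and>
     s 5 = fst w \<and> s 6 = snd w"

lemma agree_holds: "agree s s' \<Longrightarrow> holds s u w \<Longrightarrow> holds s' u w"
  by (auto simp: agree_def holds_def)

lemma agree_flag: "agree s s' \<Longrightarrow> s' 7 = s 7"
  by (simp add: agree_def)

lemma p_pos: "fst p > 0" "snd p > 0"
  using hyp_pos[OF n_pos p_hyp] by auto

lemma tests_advance:
  assumes "holds s u w"
  shows "tests advance_test s
    (approaching n (fst p + fst w) (snd p + snd w) (fst u) (snd u))"
  using assms by (auto simp: tests_def agree_def holds_def advance_test_def approaching_def Let_def)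

lemma tests_descend:
  assumes "holds s u w"
  shows "tests descend_test s
    (\<lambda>k. n \<le> fst (p + u + k *\<^sub>R w) * snd (p + u + k *\<^sub>R w))"
  using assms by (auto simp: tests_def agree_def holds_def descend_test_def)

lemma tests_jump:
  assumes "holds s u w"
  shows "tests jump_test s (\<lambda>k. n \<le> fst (p + k *\<^sub>R u) * snd (p + k *\<^sub>R u))"
  using assms by (auto simp: tests_def agree_def holds_def jump_test_def)

text \<open>Since \<open>u + w\<close> is feasible already, the search starts there, whence
  \<open>Suc k\<close>. A test costs 8, giving the factor \<open>2 * 8 + 5 = 21\<close>; 48 is
  \<open>2 * 21\<close> plus six operations in assignments.\<close>

lemma runs_descend:
  assumes u: "p + u + w \<in> hyp n" and w: "fst w \<ge> 0" "snd w < 0"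
  obtains k :: nat where
    "p + (u + of_nat (Suc k) *\<^sub>R w) \<in> hyp n" "p + (u + of_nat (Suc k) *\<^sub>R w) + w \<notin> hyp n"
    "\<And>s. holds s u w \<Longrightarrow> runs descend s (48 + 21 * log 2 (1 + k))
       (\<lambda>s'. holds s' (u + of_nat (Suc k) *\<^sub>R w) w \<and> s' 7 = s 7)"
proof -
  define u1 where "u1 = u + w"
  have u1: "p + u1 \<in> hyp n" using u by (simp add: u1_def add.assoc)
  obtain K where K: "\<And>k :: nat. k \<ge> 1 \<Longrightarrow>
        n \<le> fst (p + u1 + k *\<^sub>R w) * snd (p + u1 + k *\<^sub>R w) \<longleftrightarrow> k \<le> K"
      "p + u1 + K *\<^sub>R w \<in> hyp n" "p + u1 + Suc K *\<^sub>R w \<notin> hyp n"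
    using feasible_search[OF n_pos u1 w] by blast
  have eq: "u + of_nat (Suc K) *\<^sub>R w = u1 + K *\<^sub>R w" by (simp add: u1_def algebra_simps)
  show thesis
  proof (rule that[of K])
    show "p + (u + of_nat (Suc K) *\<^sub>R w) \<in> hyp n" "p + (u + of_nat (Suc K) *\<^sub>R w) + w \<notin> hyp n"
      using K(2,3) by (simp_all add: u1_def algebra_simps)
    fix s assume s: "holds s u w"
    define s1 where "s1 = s(3 := fst u1, 4 := snd u1)"
    have s1: "holds s1 u1 w" "s1 7 = s 7" using s by (auto simp: s1_def holds_def)
    have "runs (Seq (gallop descend_test)
       (Seq (Assign 3 (Add (Var 3) (Mul (Var 9) (Var 5)))) (Assign 4 (Add (Var 4) (Mul (Var 9) (Var 6))))))
       s1 (real (2 * bcost descend_test + 5) * (2 + log 2 (1 + K)) + 4)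
       (\<lambda>s'. holds s' (u1 + K *\<^sub>R w) w \<and> s' 7 = s1 7)"
    proof (rule runs_Seq[OF runs_gallop[OF tests_descend[OF s1(1)] K(1)]])
      fix s' assume s': "agree s1 s' \<and> s' 9 = real K"
      then have "holds s' u1 w" "s' 7 = s1 7" using agree_holds s1 agree_flag by blast+
      then show "runs (Seq (Assign 3 (Add (Var 3) (Mul (Var 9) (Var 5))))
          (Assign 4 (Add (Var 4) (Mul (Var 9) (Var 6))))) s' 4
          (\<lambda>s'. holds s' (u1 + K *\<^sub>R w) w \<and> s' 7 = s1 7)"
        using s' by (intro runs_Assign_Seq runs_Assign) (auto simp: holds_def)
    qed
    then have "runs descend s (real (2 * bcost descend_test + 5) * (2 + log 2 (1 + K)) + 6)
        (\<lambda>s'. holds s' (u1 + K *\<^sub>R w) w \<and> s' 7 = s1 7)"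
      unfolding descend_def using s
      by (intro runs_Assign_Seq) (simp add: s1_def u1_def holds_def add.commute[of 4])
    then show "runs descend s (48 + 21 * log 2 (1 + K))
         (\<lambda>s'. holds s' (u + of_nat (Suc K) *\<^sub>R w) w \<and> s' 7 = s 7)"
      unfolding eq s1(2) by (rule runs_mono) (simp_all add: descend_test_def)
  qed
qed

lemma line_feasible_iff:
  assumes "fst u > 0" "fst w \<ge> 0"
  shows "p + w + real k *\<^sub>R u \<in> hyp n \<longleftrightarrow>
    n \<le> (fst p + fst w + k * fst u) * (snd p + snd w + k * snd u)"
  using assms p_pos by (subst hyp_iff[OF n_pos]) (auto simp: add_pos_nonneg)

text \<open>A round at least doubles the first coordinate, so \<open>log 2 r \<ge> 1\<close> absorbs
  the constants: \<open>2 * 43 + 58 + 43 + 21 = 208\<close>.\<close>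

lemma narrow_cost:
  fixes a k :: nat and r :: real
  assumes "a \<ge> 1" "1 + of_nat a * of_nat (Suc k) \<le> r"
  shows "43 * (2 + log 2 (1 + a)) + (58 + 21 * log 2 (1 + k)) \<le> 208 * log 2 r"
proof -
  have "1 \<le> real a" using assms(1) by simp
  moreover have "real a * 1 \<le> real a * real (Suc k)" by (intro mult_left_mono) auto
  moreover have "1 + real k \<le> real a * real (Suc k)"
    using mult_right_mono[of 1 "real a" "1 + real k"] assms(1) by simp
  ultimately have "2 \<le> r" "1 + real a \<le> r" "1 + real k \<le> r" using assms(2) by linarith+
  then have "log 2 2 \<le> log 2 r" "log 2 (1 + a) \<le> log 2 r" "log 2 (1 + k) \<le> log 2 r"
    by (simp_all add: log_le_cancel_iff del: log_eq_one)
  then show ?thesis by simp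
qed

text \<open>A productive round is paid for by the growth of \<open>fst u\<close>. The last round
  brings no growth, so its search length \<open>K\<close> is controlled by the height of
  \<open>p\<close> instead.\<close>

lemma runs_narrow:
  assumes enc: "enclosing D u0 u w" and s: "holds s u w" "s 7 = 0"
  obtains
    (step) u' w' where "enclosing D u0 u' w'" "2 * fst u \<le> fst u'"
      "runs narrow s (208 * log 2 (fst u' / fst u)) (\<lambda>s'. holds s' u' w' \<and> s' 7 = 0)"
  | (stop) K where "minsl n L p = u" "K = 0 \<or> snd u < 0 \<and> of_nat K * (- snd u) \<le> snd p"
      "runs narrow s (97 + 43 * log 2 (1 + K)) (\<lambda>s'. \<exists>w. holds s' u w \<and> s' 7 = 1)"
proof -
  have u: "fst u > 0" and w: "fst w \<ge> 0" "snd w < 0" and out: "p + w \<notin> hyp n"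
    using enc by (auto simp: enclosing_def)
  define X Y where "X = fst p + fst w" and "Y = snd p + snd w"
  have X: "X > 0" using p_pos w by (simp add: X_def)
  have line: "p + w + real k *\<^sub>R u \<in> hyp n \<longleftrightarrow> n \<le> (X + k * fst u) * (Y + k * snd u)" for k
    using line_feasible_iff[OF u w(1)] by (simp add: X_def Y_def)
  have "X * Y < n" using line[of 0] out by simp
  from approaching_search[OF n_pos X u this, of "snd u"]
  obtain K where K: "\<And>k. k \<ge> 1 \<Longrightarrow> approaching n X Y (fst u) (snd u) k \<longleftrightarrow> k \<le> K"
    and before: "\<And>j :: nat. j \<le> K \<Longrightarrow> (X + j * fst u) * (Y + j * snd u) < n"
    and never: "\<And>j :: nat. (X + Suc K * fst u) * (Y + Suc K * snd u) < n \<Longrightarrow>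
        (X + j * fst u) * (Y + j * snd u) < n"
    and short: "(X + Suc K * fst u) * (Y + Suc K * snd u) < n \<Longrightarrow> K \<ge> 1 \<Longrightarrow>
        snd u < 0 \<and> K * (- snd u) \<le> Y"
    by blast
  define w' where "w' = w + of_nat K *\<^sub>R u"
  let ?B = "Leq (Var 0) (Mul (Add (Add (Var 1) (Var 3)) (Var 5)) (Add (Add (Var 2) (Var 4)) (Var 6)))"
  have meet: "p + u + w' \<in> hyp n \<longleftrightarrow> n \<le> (X + Suc K * fst u) * (Y + Suc K * snd u)"
    using line[of "Suc K"] by (simp add: w'_def algebra_simps)
  have fstw': "fst w' \<ge> 0" using u w by (simp add: w'_def)
  have B: "bval ?B s' \<longleftrightarrow> p + u + w' \<in> hyp n" if "holds s' u w'" for s'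
    using that hyp_iff[OF n_pos, of "p + u + w'"] u fstw' p_pos by (simp add: holds_def add_pos_nonneg)
  have cost: "real (2 * bcost advance_test + 5) = 43" by (simp add: advance_test_def Let_def)
  have narrow: "runs narrow s (43 * (2 + log 2 (1 + K)) + (10 + T)) Q"
    if cond: "\<And>s'. holds s' u w' \<Longrightarrow> s' 7 = 0 \<Longrightarrow> runs (Cond ?B descend (Assign 7 (Const 1))) s' (6 + T) Q"
    for T Q
    unfolding narrow_def
  proof (rule runs_Seq)
    show "runs (gallop advance_test) s (43 * (2 + log 2 (1 + K)))
        (\<lambda>s'. agree s s' \<and> s' 9 = real K)"
      using runs_gallop[OF tests_advance[OF s(1)]] K unfolding cost X_def Y_def by blast
    fix s' assume s': "agree s s' \<and> s' 9 = real K"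
    then have h: "holds s' u w" "s' 7 = 0" using agree_holds agree_flag s by (blast, metis)
    show "runs (Seq (Assign 5 (Add (Var 5) (Mul (Var 9) (Var 3))))
        (Seq (Assign 6 (Add (Var 6) (Mul (Var 9) (Var 4)))) (Cond ?B descend (Assign 7 (Const 1))))) s'
        (10 + T) Q"
    proof (intro runs_Assign_Seq)
      let ?s = "s'(5 := aval (Add (Var 5) (Mul (Var 9) (Var 3))) s')"
      let ?s = "?s(6 := aval (Add (Var 6) (Mul (Var 9) (Var 4))) ?s)"
      have "runs (Cond ?B descend (Assign 7 (Const 1))) ?s (6 + T) Q"
        using h s' by (intro cond) (auto simp: holds_def w'_def)
      then show "runs (Cond ?B descend (Assign 7 (Const 1))) ?s
          (10 + T - real (acost (Add (Var 5) (Mul (Var 9) (Var 3))))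
            - real (acost (Add (Var 6) (Mul (Var 9) (Var 4))))) Q"
        by simp
    qed
  qed
  have costB: "real (bcost ?B) = 6" by simp
  show thesis
  proof (cases "p + u + w' \<in> hyp n")
    case True
    have out': "p + w' \<notin> hyp n" using before[of K] line[of K] by (simp add: w'_def add.assoc)
    have sndw': "snd w' < 0"
    proof (rule ccontr)
      assume "\<not> snd w' < 0"
      then show False using out' hyp_add_nonneg[OF n_pos p_hyp fstw'] by simp
    qed
    from runs_descend[OF True fstw' sndw'] obtain k :: nat
      where k: "p + (u + of_nat (Suc k) *\<^sub>R w') \<in> hyp n" "p + (u + of_nat (Suc k) *\<^sub>R w') + w' \<notin> hyp n"
        and desc: "\<And>s. holds s u w' \<Longrightarrow> runs descend s (48 + 21 * log 2 (1 + k))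
          (\<lambda>s'. holds s' (u + of_nat (Suc k) *\<^sub>R w') w' \<and> s' 7 = s 7)"
      by blast
    have "runs narrow s (43 * (2 + log 2 (1 + K)) + (10 + (48 + 21 * log 2 (1 + k))))
        (\<lambda>s'. holds s' (u + of_nat (Suc k) *\<^sub>R w') w' \<and> s' 7 = 0)"
    proof (rule narrow)
      fix s' assume h: "holds s' u w'" "s' 7 = 0"
      show "runs (Cond ?B descend (Assign 7 (Const 1))) s' (6 + (48 + 21 * log 2 (1 + k)))
          (\<lambda>s'. holds s' (u + of_nat (Suc k) *\<^sub>R w') w' \<and> s' 7 = 0)"
      proof (rule runs_Cond)
        show "runs descend s' (6 + (48 + 21 * log 2 (1 + k)) - real (bcost ?B))
            (\<lambda>s'. holds s' (u + of_nat (Suc k) *\<^sub>R w') w' \<and> s' 7 = 0)"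
          unfolding costB using desc[OF h(1)] h(2) by simp
      qed (use B[OF h(1)] True in simp)
    qed
    then have run: "runs narrow s (43 * (2 + log 2 (1 + K)) + (58 + 21 * log 2 (1 + k)))
        (\<lambda>s'. holds s' (u + of_nat (Suc k) *\<^sub>R w') w' \<and> s' 7 = 0)"
      by simp
    define u' where "u' = u + of_nat (Suc k) *\<^sub>R w'"
    have no: "p + w + of_nat j *\<^sub>R u \<notin> hyp n" if "j \<le> K" for j
      using before[OF that] line[of j] by simp
    have st: "enclosing D u0 u' w'" "fst u' \<ge> fst u * (1 + of_nat K * of_nat (Suc k))" "K \<ge> 1"
      using enclosing_step[OF enc _ w'_def u'_def True k[folded u'_def]] no by blast+
    have r: "1 + of_nat K * of_nat (Suc k) \<le> fst u' / fst u"
      using st(2) u by (simp add: pos_le_divide_eq mult.commute)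
    have "real K * real (Suc k) \<ge> 1 * 1" using st(3) by (intro mult_mono) auto
    then have "2 \<le> fst u' / fst u" using r by linarith
    then have "2 * fst u \<le> fst u'" using u by (simp add: pos_le_divide_eq)
    moreover have "runs narrow s (208 * log 2 (fst u' / fst u)) (\<lambda>s'. holds s' u' w' \<and> s' 7 = 0)"
      using run narrow_cost[OF st(3) r] unfolding u'_def by (rule runs_mono)
    ultimately show thesis by (rule step[OF st(1)])
  next
    case False
    then have S: "(X + Suc K * fst u) * (Y + Suc K * snd u) < n" using meet by simp
    have "minsl n L p = u"
      using no_feasible_below[OF enc] line never[OF S] by (simp add: not_le)
    moreover have "K = 0 \<or> snd u < 0 \<and> of_nat K * (- snd u) \<le> snd p"
      using short[OF S] w by (auto simp: Y_def)
    moreover have "runs narrow s (43 * (2 + log 2 (1 + K)) + (10 + 0)) (\<lambda>s'. \<exists>w. holds s' u w \<and> s' 7 = 1)"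
    proof (rule narrow)
      fix s' assume h: "holds s' u w'" "s' 7 = 0"
      show "runs (Cond ?B descend (Assign 7 (Const 1))) s' (6 + 0) (\<lambda>s'. \<exists>w. holds s' u w \<and> s' 7 = 1)"
      proof (rule runs_Cond)
        show "runs (Assign 7 (Const 1)) s' (6 + 0 - real (bcost ?B)) (\<lambda>s'. \<exists>w. holds s' u w \<and> s' 7 = 1)"
          unfolding costB using h by (intro runs_Assign exI[of _ w']) (auto simp: holds_def)
      qed (use B[OF h(1)] False in simp)
    qed
    then have "runs narrow s (97 + 43 * log 2 (1 + K)) (\<lambda>s'. \<exists>w. holds s' u w \<and> s' 7 = 1)"
      by (rule runs_mono) auto
    ultimately show thesis by (rule stop)
  qed
qed

lemma runs_narrow_loop:
  assumes bound: "\<And>u w. enclosing D u0 u w \<Longrightarrow> fst u \<le> M"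
      "\<And>u w. enclosing D u0 u w \<Longrightarrow> snd u < 0 \<Longrightarrow> snd p \<le> A * (- snd u)"
    and A: "A \<ge> 0"
  shows "enclosing D u0 u w \<Longrightarrow> holds s u w \<Longrightarrow> s 7 = 0 \<Longrightarrow>
    runs (While (Eq (Var 7) (Const 0)) narrow) s
      (209 * log 2 (M / fst u) + (99 + 43 * log 2 (1 + A)))
      (\<lambda>s'. \<exists>w w'. holds s' (minsl n L p) w \<and> enclosing D u0 (minsl n L p) w')"
proof (induction "nat \<lfloor>M / fst u\<rfloor>" arbitrary: u w s rule: less_induct)
  case less
  note enc = less.prems(1)
  have u: "fst u > 0" "fst u \<le> M" using enc bound(1)[OF enc] by (simp_all add: enclosing_def)
  have go: "bval (Eq (Var 7) (Const 0)) s" using less.prems by simp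
  show ?case
    using enc less.prems(2,3)
  proof (cases rule: runs_narrow)
    case (step u' w')
    have u': "fst u' > 0" "fst u' \<le> M" using step(1) bound(1)[OF step(1)] by (simp_all add: enclosing_def)
    \<comment> \<open>The quotient at least halves but stays at least \<open>1\<close>, so it drops
      by \<open>1\<close> or more and its floor strictly decreases.\<close>
    have "M / fst u' \<le> M / (2 * fst u)" using step(2) u u' by (intro divide_left_mono) auto
    moreover have "1 \<le> M / fst u'" using u' by simp
    ultimately have "M / fst u' + 1 \<le> M / fst u" by (simp add: field_simps)
    then have "nat \<lfloor>M / fst u'\<rfloor> < nat \<lfloor>M / fst u\<rfloor>" using \<open>1 \<le> M / fst u'\<close> by linarith
    note IH = less.hyps[OF this step(1)]
    have ratio: "2 \<le> fst u' / fst u" using step(2) u by (simp add: pos_le_divide_eq)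
    have "log 2 2 \<le> log 2 (fst u' / fst u)" using ratio by (subst log_le_cancel_iff) auto
    then have r: "1 \<le> log 2 (fst u' / fst u)" by simp
    \<comment> \<open>The costs telescope; 209 is 208 plus one for the loop test, covered because
      the logarithm of the ratio is at least \<open>1\<close>.\<close>
    have "log 2 (M / fst u) = log 2 ((M / fst u') * (fst u' / fst u))" using u' by simp
    also have "\<dots> = log 2 (M / fst u') + log 2 (fst u' / fst u)"
      using u u' by (intro log_mult_pos) auto
    finally have split: "log 2 (M / fst u) = log 2 (M / fst u') + log 2 (fst u' / fst u)" .
    show ?thesis
      by (rule runs_mono[OF runs_While_step[OF go step(3) IH]]) (use split r in auto)
  next
    case (stop K)
    have "real K \<le> A"
    proof (cases "K = 0")
      case True
      then show ?thesis using A by simp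
    next
      case False
      then have neg: "snd u < 0" and "real K * (- snd u) \<le> snd p" using stop(2) by blast+
      then have "real K * (- snd u) \<le> A * (- snd u)" using bound(2)[OF enc neg] by linarith
      then show ?thesis using neg by (intro mult_right_le_imp_le[of "real K" "- snd u" A]) simp_all
    qed
    then have K: "log 2 (1 + K) \<le> log 2 (1 + A)" using A by (subst log_le_cancel_iff) auto
    have "1 \<le> M / fst u" using u by simp
    then have M: "0 \<le> log 2 (M / fst u)" by simp
    have "runs (While (Eq (Var 7) (Const 0)) narrow) s'
        1 (\<lambda>s'. \<exists>w w'. holds s' (minsl n L p) w \<and> enclosing D u0 (minsl n L p) w')"
      if "\<exists>w. holds s' u w \<and> s' 7 = 1" for s'
    proof (rule runs_While_exit)
      show "\<exists>w w'. holds s' (minsl n L p) w \<and> enclosing D u0 (minsl n L p) w'"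
        using that enc unfolding stop(1) by blast
    qed (use that in auto)
    from runs_While_step[OF go stop(3) this]
    show ?thesis by (rule runs_mono) (use K M in auto)
  qed
qed

text \<open>The test costs 6, giving \<open>2 * 6 + 5 = 17\<close>; 39 is \<open>2 * 17\<close> plus
  four operations and the branch test.\<close>

lemma runs_jump:
  assumes s: "holds s m w" and m: "minsl n L p = m" "fst m > 0"
    and A: "snd m < 0 \<Longrightarrow> snd p \<le> A * (- snd m)" "A \<ge> 0"
  shows "runs jump s (39 + 17 * log 2 (1 + A)) (\<lambda>s'. result s' = nextpt n L p)"
proof (cases "snd m < 0")
  case True
  obtain K where K: "\<And>k :: nat. k \<ge> 1 \<Longrightarrow> n \<le> fst (p + k *\<^sub>R m) * snd (p + k *\<^sub>R m) \<longleftrightarrow> k \<le> K"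
      "p + K *\<^sub>R m \<in> hyp n" "p + Suc K *\<^sub>R m \<notin> hyp n" "K * (- snd m) \<le> snd p"
    using feasible_search[OF n_pos p_hyp _ True] m by (metis less_imp_le)
  have "real K * (- snd m) \<le> A * (- snd m)" using K(4) A(1)[OF True] by (rule order_trans)
  then have "real K \<le> A" using True by (intro mult_right_le_imp_le[of "real K" "- snd m" A]) simp_all
  then have logK: "log 2 (1 + K) \<le> log 2 (1 + A)" using A by (subst log_le_cancel_iff) auto
  have target: "nextpt n L p = Some (p + K *\<^sub>R m)"
    using nextpt_SomeI[of n p K L] n_pos p_hyp K m by simp
  have "runs (Seq (gallop jump_test)
      (Seq (Assign 1 (Add (Var 1) (Mul (Var 9) (Var 3)))) (Assign 2 (Add (Var 2) (Mul (Var 9) (Var 4))))))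
      s (real (2 * bcost jump_test + 5) * (2 + log 2 (1 + K)) + 4) (\<lambda>s'. result s' = nextpt n L p)"
  proof (rule runs_Seq[OF runs_gallop[OF tests_jump[OF s] K(1)]])
    fix s' assume s': "agree s s' \<and> s' 9 = real K"
    then have "holds s' m w" using agree_holds s by blast
    then show "runs (Seq (Assign 1 (Add (Var 1) (Mul (Var 9) (Var 3))))
        (Assign 2 (Add (Var 2) (Mul (Var 9) (Var 4))))) s' 4 (\<lambda>s'. result s' = nextpt n L p)"
      using s' n_pos target
      by (intro runs_Assign_Seq runs_Assign) (auto simp: holds_def result_def prod_eq_iff)
  qed
  then have "runs (Seq (gallop jump_test)
      (Seq (Assign 1 (Add (Var 1) (Mul (Var 9) (Var 3)))) (Assign 2 (Add (Var 2) (Mul (Var 9) (Var 4))))))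
      s (38 + 17 * log 2 (1 + A)) (\<lambda>s'. result s' = nextpt n L p)"
    by (rule runs_mono) (use logK in \<open>auto simp: jump_test_def\<close>)
  then show ?thesis
    unfolding jump_def using s True by (intro runs_Cond) (auto simp: holds_def)
next
  case False
  have "nextpt n L p = None"
    using nextpt_NoneI[OF n_pos p_hyp, of L] m False by simp
  moreover have "0 \<le> log 2 (1 + A)" using A(2) by simp
  ultimately show ?thesis
    unfolding jump_def using s False
    by (intro runs_Cond runs_Assign) (auto simp: holds_def result_def)
qed

lemma runs_search:
  assumes bound: "\<And>u w. enclosing D u0 u w \<Longrightarrow> fst u \<le> M"
      "\<And>u w. enclosing D u0 u w \<Longrightarrow> snd u < 0 \<Longrightarrow> snd p \<le> A * (- snd u)"
    and A: "A \<ge> 0" and "enclosing D u0 u w" "holds s u w" "s 7 = 0"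
  shows "runs search s (138 + 209 * log 2 (M / fst u) + 60 * log 2 (1 + A))
    (\<lambda>s'. result s' = nextpt n L p)"
proof -
  have "runs search s
      ((209 * log 2 (M / fst u) + (99 + 43 * log 2 (1 + A))) + (39 + 17 * log 2 (1 + A)))
      (\<lambda>s'. result s' = nextpt n L p)"
    unfolding search_def
  proof (rule runs_Seq[OF runs_narrow_loop[OF assms]])
    fix s' assume "\<exists>w w'. holds s' (minsl n L p) w \<and> enclosing D u0 (minsl n L p) w'"
    then obtain w w' where "holds s' (minsl n L p) w" and enc: "enclosing D u0 (minsl n L p) w'"
      by blast
    then show "runs jump s' (39 + 17 * log 2 (1 + A)) (\<lambda>s'. result s' = nextpt n L p)"
      using bound(2)[OF enc] A by (intro runs_jump) (auto simp: enclosing_def)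
  qed
  then show ?thesis by (rule runs_mono) auto
qed

end

section \<open>Initialisation from the standard basis\<close>

locale standard_walk =
  fixes n :: real and L :: "point set" and p b1 b2 :: point
  assumes n_gt: "n > 0" and p_in: "p \<in> hyp n" and basis: "standard_basis L b1 b2"
begin

lemma basis_simps: "fst b1 > 0" "fst b2 = 0" "snd b2 > 0" "0 \<le> snd b1"
  and L_eq: "L = {of_int i *\<^sub>R b1 + of_int j *\<^sub>R b2 | i j :: int. True}"
  using basis by (auto simp: standard_basis_def lattice_basis_def)

lemma in_L: "of_int i *\<^sub>R b1 + of_int j *\<^sub>R b2 \<in> L"
  unfolding L_eq by blast

lemma basis_in_L: "b1 \<in> L" "b2 \<in> L"
  using in_L[of 1 0] in_L[of 0 1] by simp_all

sublocale hyperbola_walk n L p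
proof
  fix u w and a b :: int assume "u \<in> L" "w \<in> L"
  then obtain i j k l :: int
    where "u = of_int i *\<^sub>R b1 + of_int j *\<^sub>R b2" "w = of_int k *\<^sub>R b1 + of_int l *\<^sub>R b2"
    unfolding L_eq by blast
  then have "of_int a *\<^sub>R u + of_int b *\<^sub>R w
      = of_int (a * i + b * k) *\<^sub>R b1 + of_int (a * j + b * l) *\<^sub>R b2"
    by (simp add: algebra_simps)
  then show "of_int a *\<^sub>R u + of_int b *\<^sub>R w \<in> L" using in_L by metis
qed (fact n_gt p_in)+

text \<open>The floor matches the \<open>IDiv\<close> of \<open>next_point\<close>, taken once at
  \<open>p\<close> and once at \<open>p + b1\<close>.\<close>

definition max_drop :: "point \<Rightarrow> int" where
  "max_drop q = \<lfloor>(fst q * snd q - n) / (fst q * snd b2)\<rfloor>"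

lemma le_max_drop_iff:
  assumes "fst q > 0"
  shows "k \<le> max_drop q \<longleftrightarrow> q - of_int k *\<^sub>R b2 \<in> hyp n"
proof -
  have pos: "fst q * snd b2 > 0" using assms basis_simps by simp
  have "k \<le> max_drop q \<longleftrightarrow> of_int k * (fst q * snd b2) \<le> fst q * snd q - n"
    unfolding max_drop_def le_floor_iff using pos by (simp add: pos_le_divide_eq)
  also have "\<dots> \<longleftrightarrow> n \<le> fst q * (snd q - of_int k * snd b2)"
    by (simp add: algebra_simps)
  also have "\<dots> \<longleftrightarrow> q - of_int k *\<^sub>R b2 \<in> hyp n"
    using assms basis_simps hyp_iff[OF n_pos, of "q - of_int k *\<^sub>R b2"] by simp
  finally show ?thesis .
qed

text \<open>The cross product of \<open>- b2\<close> with \<open>v\<close> is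
  \<open>snd b2 * fst v\<close>, so the vertical step is minimal as soon as it is feasible.\<close>

lemma nextpt_vertical:
  assumes "max_drop p \<ge> 1"
  shows "nextpt n L p = Some (p - of_int (max_drop p) *\<^sub>R b2)"
proof -
  have minsl: "minsl n L p = - b2"
  proof (rule minsl_eqI[where w = b1])
    show "spans L (- b2) b1"
      unfolding spans_def
    proof (intro conjI ballI)
      show "- b2 \<in> L" "b1 \<in> L" using in_L[of 0 "- 1"] basis_in_L by simp_all
      fix v assume "v \<in> L"
      then obtain i j :: int where "v = of_int i *\<^sub>R b1 + of_int j *\<^sub>R b2" unfolding L_eq by blast
      then have "v = of_int (- j) *\<^sub>R (- b2) + of_int i *\<^sub>R b1" by simp
      then show "\<exists>a b. v = of_int a *\<^sub>R (- b2) + of_int b *\<^sub>R b1" by blast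
    qed
    show "cross (- b2) b1 \<noteq> 0" using basis_simps by (simp add: cross_def)
    have "p - b2 \<in> hyp n" using le_max_drop_iff[OF p_pos(1), of 1] assms by simp
    then show "- b2 \<in> steps_right n L p"
      using in_L[of 0 "- 1"] basis_simps by (auto simp: steps_right_iff)
    show "fst (- b2) > 0 \<or> fst (- b2) = 0 \<and> snd (- b2) < 0" using basis_simps by simp
    fix v assume "v \<in> steps_right n L p"
    then show "cross (- b2) v \<ge> 0" using basis_simps by (simp add: cross_def steps_right_iff)
  qed
  have "int (nat (max_drop p)) = max_drop p" using assms by simp
  then have d: "real (nat (max_drop p)) = of_int (max_drop p)" by linarith
  have "nextpt n L p = Some (p + of_nat (nat (max_drop p)) *\<^sub>R minsl n L p)"
  proof (rule nextpt_SomeI)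
    show "p + of_nat (nat (max_drop p)) *\<^sub>R minsl n L p \<in> hyp n"
      using le_max_drop_iff[OF p_pos(1), of "max_drop p"] by (simp add: minsl d)
    show "p + of_nat (Suc (nat (max_drop p))) *\<^sub>R minsl n L p \<notin> hyp n"
      using le_max_drop_iff[OF p_pos(1), of "max_drop p + 1"] by (simp add: minsl d algebra_simps)
  qed (use n_pos p_hyp in auto)
  then show ?thesis by (simp add: minsl d)
qed

text \<open>The lowest feasible lattice vector in the column of \<open>b1\<close>.\<close>

definition start :: point where
  "start = b1 - of_int (max_drop (p + b1)) *\<^sub>R b2"

lemma fst_start [simp]: "fst start = fst b1"
  by (simp add: start_def basis_simps)

lemma start_feasible: "p + start \<in> hyp n" "p + start - b2 \<notin> hyp n"
proof -
  have pos: "fst (p + b1) > 0" using p_pos basis_simps by simp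
  show "p + start \<in> hyp n"
    using le_max_drop_iff[OF pos, of "max_drop (p + b1)"] by (simp add: start_def algebra_simps)
  show "p + start - b2 \<notin> hyp n"
    using le_max_drop_iff[OF pos, of "max_drop (p + b1) + 1"] by (simp add: start_def algebra_simps)
qed

lemma enclosing_start:
  assumes "max_drop p < 1"
  shows "enclosing (fst b1 * snd b2) start start (- b2)"
proof -
  have out: "p - b2 \<notin> hyp n" using le_max_drop_iff[OF p_pos(1), of 1] assms by simp
  have sp: "spans L start (- b2)"
    unfolding spans_def
  proof (intro conjI ballI)
    show "start \<in> L" "- b2 \<in> L"
      using in_L[of 1 "- max_drop (p + b1)"] in_L[of 0 "- 1"] by (simp_all add: start_def)
    fix v assume "v \<in> L"
    then obtain i j :: int where "v = of_int i *\<^sub>R b1 + of_int j *\<^sub>R b2" unfolding L_eq by blast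
    then have "v = of_int i *\<^sub>R start + of_int (- (i * max_drop (p + b1) + j)) *\<^sub>R (- b2)"
      by (simp add: start_def algebra_simps)
    then show "\<exists>a b. v = of_int a *\<^sub>R start + of_int b *\<^sub>R (- b2)" by blast
  qed
  have below: "p + (of_int a *\<^sub>R start + of_int b *\<^sub>R (- b2)) \<notin> hyp n"
    if ab: "a \<le> 0" "b \<ge> 1" and right: "fst (of_int a *\<^sub>R start + of_int b *\<^sub>R (- b2)) \<ge> 0" for a b :: int
  proof
    assume "p + (of_int a *\<^sub>R start + of_int b *\<^sub>R (- b2)) \<in> hyp n"
    \<comment> \<open>As \<open>- b2\<close> is vertical, pointing right with
      \<open>a \<le> 0\<close> leaves only multiples of \<open>- b2\<close>, the first of which is
      infeasible.\<close>
    moreover have "a = 0" using ab(1) right basis_simps by (simp add: zero_le_mult_iff)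
    ultimately have "p + of_int b *\<^sub>R (- b2) \<in> hyp n" by simp
    then have "p + 1 *\<^sub>R (- b2) \<in> hyp n" 
      using hyp_segment[of n p "of_int b" "- b2" 1] ab n_pos p_hyp by simp
    then show False using out by simp
  qed
  show ?thesis
    unfolding enclosing_def using sp basis_simps start_feasible out below
    by (auto simp: cross_def)
qed

lemma runs_next_point:
  assumes "\<And>u w. enclosing (fst b1 * snd b2) start u w \<Longrightarrow> fst u \<le> M"
      "\<And>u w. enclosing (fst b1 * snd b2) start u w \<Longrightarrow> snd u < 0 \<Longrightarrow> snd p \<le> A * (- snd u)"
    and A: "A \<ge> 0" and M: "fst b1 \<le> M"
  shows "runs next_point (input_state n p b1 b2) (160 + 209 * log 2 (M / fst b1) + 60 * log 2 (1 + A))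
    (\<lambda>s'. result s' = nextpt n L p)" (is "runs _ ?s ?T ?Q")
proof -
  have "1 \<le> M / fst b1" using M basis_simps by simp
  then have nonneg: "0 \<le> log 2 (M / fst b1)" "0 \<le> log 2 (1 + A)" using A by simp_all
  have s: "?s 0 = n" "?s 1 = fst p" "?s (Suc 0) = fst p" "?s 2 = snd p" "?s 3 = fst b1" "?s 4 = snd b1"
      "?s 5 = 0" "?s 6 = snd b2" "?s 7 = 0"
    by (simp_all add: input_state_def Let_def basis_simps)
  define s1 where "s1 = ?s(9 := of_int (max_drop p))"
  define s2 where "s2 = s1(9 := of_int (max_drop (p + b1)), 4 := snd start, 6 := - snd b2)"
  show ?thesis
    unfolding next_point_def
  proof (intro runs_Assign_Seq runs_Cond, goal_cases)
    case 1
    then have "max_drop p \<ge> 1" by (simp add: max_drop_def s)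
    from nextpt_vertical[OF this] show ?case
      using nonneg n_pos s
      by (intro runs_Assign) (auto simp: result_def max_drop_def prod_eq_iff basis_simps)
  next
    case 2
    then have "max_drop p < 1" by (simp add: max_drop_def s)
    then have "runs search s2 (138 + 209 * log 2 (M / fst start) + 60 * log 2 (1 + A)) ?Q"
      using assms s
      by (intro runs_search[OF _ _ _ enclosing_start]) (auto simp: holds_def s2_def s1_def basis_simps)
    \<comment> \<open>The set-up takes 15 of the 160 operations, which leaves 145.\<close>
    then have "runs search s2 (145 + (209 * log 2 (M / fst b1) + 60 * log 2 (1 + A))) ?Q"
      by (rule runs_mono) auto
    then show ?case
      using s by (simp add: s2_def s1_def max_drop_def start_def basis_simps)
  qed
qed

end

section \<open>Bounds on the basis vectors\<close>

text \<open>A common denominator of the two generators' second coordinates serves the whole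
  lattice.\<close>

lemma rational_lattice_discrete:
  assumes "rational_lattice L"
  obtains h :: real where "h > 0" "\<And>v. v \<in> L \<Longrightarrow> snd v < 0 \<Longrightarrow> h \<le> - snd v"
proof -
  obtain b1 b2 where L: "L = {of_int i *\<^sub>R b1 + of_int j *\<^sub>R b2 | i j :: int. True}"
    and rat: "L \<subseteq> \<rat> \<times> \<rat>"
    using assms by (auto simp: rational_lattice_def lattice_basis_def)
  have "of_int 1 *\<^sub>R b1 + of_int 0 *\<^sub>R b2 \<in> L" "of_int 0 *\<^sub>R b1 + of_int 1 *\<^sub>R b2 \<in> L"
    unfolding L by blast+
  then have "snd b1 \<in> \<rat>" "snd b2 \<in> \<rat>" using rat by (auto simp: mem_Times_iff)
  then obtain a b c d :: int where ab: "b > 0" "snd b1 = of_int a / of_int b"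
    and cd: "d > 0" "snd b2 = of_int c / of_int d"
    by (metis Rats_cases')
  have pos: "real_of_int (b * d) > 0" using ab cd by simp
  show thesis
  proof (rule that[of "1 / of_int (b * d)"])
    show "0 < 1 / real_of_int (b * d)" using pos by simp
    fix v assume "v \<in> L" and neg: "snd v < 0"
    then obtain i j :: int where "v = of_int i *\<^sub>R b1 + of_int j *\<^sub>R b2" unfolding L by blast
    then have "snd v = of_int i * (of_int a / of_int b) + of_int j * (of_int c / of_int d)"
      by (simp add: ab cd)
    then have v: "snd v * of_int (b * d) = of_int (i * a * d + j * c * b)"
      using ab(1) cd(1) by (simp add: field_simps)
    moreover have "snd v * of_int (b * d) < 0" using neg pos by (rule mult_neg_pos)
    ultimately have "real_of_int (i * a * d + j * c * b) < 0" by (simp only:)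
    then have "i * a * d + j * c * b \<le> - 1" by linarith
    then have "real_of_int (i * a * d + j * c * b) \<le> - 1" by linarith
    then have "snd v * of_int (b * d) \<le> - 1" by (simp only: v)
    then show "1 / of_int (b * d) \<le> - snd v" using pos by (simp add: divide_le_eq)
  qed
qed

context standard_walk
begin

text \<open>Halting needs only some bound for each input. A feasible descending vector caps
  \<open>fst u\<close> if there is one; otherwise no \<open>u\<close> descends and the fixed
  determinant caps it.\<close>

lemma enclosing_bounds_rational:
  assumes "rational_lattice L"
  obtains M A where "\<And>u w. enclosing D u0 u w \<Longrightarrow> fst u \<le> M"
    "\<And>u w. enclosing D u0 u w \<Longrightarrow> snd u < 0 \<Longrightarrow> snd p \<le> A * (- snd u)"
    "A \<ge> 0" "fst b1 \<le> M"
proof -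
  obtain h :: real where h: "h > 0" "\<And>v. v \<in> L \<Longrightarrow> snd v < 0 \<Longrightarrow> h \<le> - snd v"
    using rational_lattice_discrete[OF assms] by blast
  have "\<exists>M. \<forall>u w. enclosing D u0 u w \<longrightarrow> fst u \<le> M"
  proof (cases "\<exists>v\<in>L. fst v \<ge> 0 \<and> snd v < 0 \<and> p + v \<in> hyp n")
    case True
    then obtain v where v: "v \<in> L" "fst v \<ge> 0" "snd v < 0" "p + v \<in> hyp n" by blast
    have "fst u \<le> snd p * fst v / (- snd v)" if "enclosing D u0 u w" for u w
      using enclosing_bound_of_descent[OF that v] v(3) by (subst pos_le_divide_eq) auto
    then show ?thesis by blast
  next
    case False
    have "fst u \<le> D / h" if enc: "enclosing D u0 u w" for u w
    proof -
      have u: "u \<in> L" "w \<in> L" "fst u \<ge> 0" "snd w < 0" "p + u \<in> hyp n"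
        using enc by (auto simp: enclosing_def spans_def)
      then have "snd u \<ge> 0" using False by force
      then have "fst u * h \<le> D" using enclosing_bound_of_flat[OF enc] h(2)[OF u(2,4)] by blast
      then show ?thesis using h(1) by (simp add: pos_le_divide_eq)
    qed
    then show ?thesis by blast
  qed
  then obtain M where M: "\<And>u w. enclosing D u0 u w \<Longrightarrow> fst u \<le> M" by blast
  show thesis
  proof (rule that[of "max M (fst b1)" "snd p / h"])
    show "fst u \<le> max M (fst b1)" if "enclosing D u0 u w" for u w using M[OF that] by simp
    show "snd p \<le> snd p / h * (- snd u)" if enc: "enclosing D u0 u w" and neg: "snd u < 0" for u w
    proof -
      have "h \<le> - snd u" using enc neg h(2) by (auto simp: enclosing_def spans_def)
      then have "snd p / h * h \<le> snd p / h * (- snd u)"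
        using h(1) p_pos by (intro mult_left_mono) auto
      then show ?thesis using h(1) by simp
    qed
    show "0 \<le> snd p / h" using p_pos h(1) by simp
  qed simp
qed

lemma reduced_simps:
  assumes "reduced_lattice L"
  shows "fst b1 = 1" "snd b2 \<ge> 1" "lattice_det L = snd b2"
    and "\<And>v. v \<in> L \<Longrightarrow> snd v \<in> \<int>"
proof -
  show ints: "snd v \<in> \<int>" if "v \<in> L" for v
    using assms that by (auto simp: reduced_lattice_def)
  show "snd b2 \<ge> 1" using ints[OF basis_in_L(2)] basis_simps by (auto elim!: Ints_cases)
  have "(1::real) \<in> fst ` L" "fst b1 \<in> \<int>"
    using assms basis_in_L by (auto simp: reduced_lattice_def)
  \<comment> \<open>\<open>fst b2 = 0\<close>, so \<open>fst b1\<close> alone generates the first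
    projection and must be a unit.\<close>
  then obtain i k :: int where "1 = of_int i * fst b1" and k: "fst b1 = of_int k"
    unfolding L_eq by (auto simp: basis_simps elim!: Ints_cases)
  then have "real_of_int 1 = of_int (i * k)" by simp
  then have "i * k = 1" by linarith
  then have "k = 1 \<or> k = - 1" by (auto simp: zmult_eq_1_iff)
  then show "fst b1 = 1" using k basis_simps by auto
  then show "lattice_det L = snd b2"
    using lattice_det_eq[of L b1 b2] basis basis_simps by (simp add: standard_basis_def basis_det_def)
qed

lemma reduced_descent:
  assumes red: "reduced_lattice L" and "snd p \<ge> 2"
  obtains v where "v \<in> L" "0 \<le> fst v" "fst v \<le> n + snd b2" "snd v = - 1" "p + v \<in> hyp n"
proof -
  note r = reduced_simps[OF red]
  obtain v0 where v0: "v0 \<in> L" "snd v0 = - 1"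
  proof -
    have "- 1 \<in> snd ` L" using red by (simp add: reduced_lattice_def)
    then show thesis using that by auto
  qed
  obtain i j :: int where ij: "snd b1 = of_int i" "snd b2 = of_int j"
    using r(4) basis_in_L by (meson Ints_cases)
  \<comment> \<open>This combination cancels the second coordinate and gives a horizontal period
    equal to the determinant.\<close>
  have "of_int j *\<^sub>R b1 + of_int (- i) *\<^sub>R b2 \<in> L" by (rule in_L)
  moreover have "of_int j *\<^sub>R b1 + of_int (- i) *\<^sub>R b2 = (snd b2, 0)"
    using ij basis_simps r(1) by (simp add: prod_eq_iff)
  ultimately have flat: "(snd b2, 0) \<in> L" by simp
  \<comment> \<open>Shifts \<open>v0\<close> horizontally so that its first coordinate is at least
    \<open>n\<close> but exceeds it by at most one period. As \<open>snd p \<ge> 2\<close>, the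
    second coordinate of \<open>p + v\<close> is at least \<open>1\<close>, which suffices for
    feasibility.\<close>
  define t where "t = \<lceil>(n - fst v0) / snd b2\<rceil>"
  have "(n - fst v0) / snd b2 \<le> of_int t" "of_int t < (n - fst v0) / snd b2 + 1"
    unfolding t_def by linarith+
  then have t: "n \<le> fst v0 + of_int t * snd b2" "fst v0 + of_int t * snd b2 \<le> n + snd b2"
    using basis_simps(3) by (simp_all add: field_simps)
  define v where "v = of_int 1 *\<^sub>R v0 + of_int t *\<^sub>R (snd b2, 0 :: real)"
  have v: "v \<in> L" unfolding v_def by (intro comb v0 flat)
  have fs: "fst v = fst v0 + of_int t * snd b2" "snd v = - 1" by (simp_all add: v_def v0)
  have "n * 1 \<le> (fst p + fst v) * (snd p + snd v)"
    using t fs p_pos n_pos assms(2) by (intro mult_mono) auto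
  then have "p + v \<in> hyp n"
    using t fs p_pos n_pos hyp_iff[of n "p + v"] by simp
  then show thesis using that[of v] v fs t n_pos by simp
qed

lemma enclosing_bounds_reduced:
  assumes red: "reduced_lattice L" and p: "snd p \<notin> {1<..<2}"
    and enc: "enclosing (fst b1 * snd b2) start u w"
  defines "N \<equiv> 1 + snd b2 + n"
  shows "fst u \<le> N\<^sup>2" and "snd u < 0 \<Longrightarrow> snd p \<le> N * (- snd u)"
proof -
  note r = reduced_simps[OF red]
  have u: "u \<in> L" "w \<in> L" "p + u \<in> hyp n" "snd w < 0" "fst u \<ge> 1" "cross start u \<le> 0"
    using enc r(1) by (auto simp: enclosing_def spans_def)
  have "start \<in> L" using in_L[of 1 "- max_drop (p + b1)"] by (simp add: start_def)
  then obtain m :: int where m: "snd start = - of_int m" using r(4) by (metis Ints_cases Ints_minus minus_minus)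
  have step: "1 \<le> - snd v" if "v \<in> L" "snd v < 0" for v
    using r(4)[OF that(1)] that(2) by (auto elim!: Ints_cases)
  have N: "N \<ge> 1" "N \<le> N\<^sup>2" using r(2) n_pos by (simp_all add: N_def power2_eq_square)
  have up: "snd p + snd u > 0" using hyp_pos(2)[OF n_pos u(3)] by simp
  \<comment> \<open>One more drop below \<open>start\<close> is infeasible although the first
    coordinate there is at least \<open>1\<close>; this bounds the height of \<open>p\<close> by the
    depth \<open>m\<close> of \<open>start\<close>.\<close>
  have top: "snd p < of_int m + (snd b2 + n)"
  proof (rule ccontr)
    assume "\<not> ?thesis"
    then have "n \<le> snd p - of_int m - snd b2" by simp
    then have "1 * n \<le> (fst p + 1) * (snd p - of_int m - snd b2)"
      using p_pos n_pos by (intro mult_mono) auto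
    then show False
      using start_feasible(2) hyp_iff[OF n_pos, of "p + start - b2"] p_pos r(1) basis_simps m by simp
  qed
  have "fst u \<le> N\<^sup>2 \<and> (snd u < 0 \<longrightarrow> snd p \<le> N * (- snd u))"
  \<comment> \<open>If \<open>start\<close> descends, every later \<open>u\<close> is at least as
    steep, so its width is limited by the available height. If not, \<open>p\<close> itself is
    low.\<close>
  proof (cases "m \<ge> 1")
    case True
    then have m1: "real_of_int m \<ge> 1" by simp
    have steep: "of_int m * fst u \<le> - snd u" using u(6) r(1) m by (simp add: cross_def)
    have "of_int m + (snd b2 + n) \<le> of_int m * N"
      using mult_right_mono[OF m1, of "snd b2 + n"] basis_simps n_pos by (simp add: N_def algebra_simps)
    then have pN: "snd p \<le> of_int m * N" using top by linarith
    then have "of_int m * fst u \<le> of_int m * N" using steep up by linarith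
    then have "fst u \<le> N" using m1 by (simp add: mult_le_cancel_left)
    moreover have "of_int m * 1 \<le> of_int m * fst u" using m1 u(5) by (intro mult_left_mono) auto
    then have "of_int m \<le> - snd u" using steep by linarith
    then have "of_int m * N \<le> - snd u * N" using N by (intro mult_right_mono) auto
    ultimately show ?thesis using pN N by (simp add: mult.commute)
  next
    case False
    then have pN: "snd p < snd b2 + n" using top by (smt (verit) of_int_le_0_iff)
    have "fst u \<le> N\<^sup>2"
    proof (cases "snd p \<ge> 2")
      case True
      then obtain v where v: "v \<in> L" "0 \<le> fst v" "fst v \<le> n + snd b2" "snd v = - 1" "p + v \<in> hyp n"
        using reduced_descent[OF red] by blast
      have "fst u \<le> snd p * fst v" using enclosing_bound_of_descent[OF enc v(1,2) _ v(5)] v(4) by simp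
      also have "\<dots> \<le> N * N" using pN v p_pos by (intro mult_mono) (auto simp: N_def)
      finally show ?thesis by (simp add: power2_eq_square)
    next
      case False
      then have "snd p \<le> 1" using p by auto
      \<comment> \<open>Second coordinates are integers and feasible descents are shorter than
        \<open>snd p \<le> 1\<close>, so \<open>u\<close> cannot descend.\<close>
      then have "snd u \<ge> 0" using step[OF u(1)] up by linarith
      then have "fst u * 1 \<le> fst b1 * snd b2"
        using enclosing_bound_of_flat[OF enc] step[OF u(2,4)] by blast
      then show ?thesis using r(1) N n_pos by (simp add: N_def)
    qed
    moreover have "snd p \<le> N * (- snd u)" if "snd u < 0"
    proof -
      have "N * 1 \<le> N * (- snd u)" using step[OF u(1) that] N by (intro mult_left_mono) auto
      then show ?thesis using pN by (simp add: N_def)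
    qed
    ultimately show ?thesis by blast
  qed
  then show "fst u \<le> N\<^sup>2" "snd u < 0 \<Longrightarrow> snd p \<le> N * (- snd u)" by auto
qed

lemma runs_next_point_reduced:
  assumes red: "reduced_lattice L" and p: "snd p \<notin> {1<..<2}"
  shows "runs next_point (input_state n p b1 b2) (1200 * (1 + ln (n + lattice_det L)))
    (\<lambda>s'. result s' = nextpt n L p)"
proof -
  note r = reduced_simps[OF red]
  define N where "N = 1 + snd b2 + n"
  define l where "l = ln (n + snd b2)"
  have l: "l \<ge> 0" using r(2) n_pos by (simp add: l_def)
  have N: "N \<ge> 1" "N \<le> N\<^sup>2" using r(2) n_pos by (simp_all add: N_def power2_eq_square)
  have run: "runs next_point (input_state n p b1 b2) (160 + 209 * log 2 (N\<^sup>2 / fst b1) + 60 * log 2 (1 + N))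
      (\<lambda>s'. result s' = nextpt n L p)"
    using enclosing_bounds_reduced[OF red p] N r(1) unfolding N_def by (intro runs_next_point) auto
  have log_N: "log 2 N \<le> log 2 (1 + N)" using N by (subst log_le_cancel_iff) auto
  \<comment> \<open>\<open>1 + N\<close> is \<open>2 + snd b2 + n\<close>, and
    \<open>snd b2 \<ge> 1\<close> makes the factor 4 sufficient.\<close>
  have "log 2 (1 + N) \<le> log 2 (4 * (n + snd b2))"
    using r(2) n_pos by (subst log_le_cancel_iff) (auto simp: N_def)
  also have "log 2 (4 * (n + snd b2)) = 2 + l / ln 2"
  proof -
    have "log 2 (4 * (n + snd b2)) = log 2 4 + log 2 (n + snd b2)"
      using r(2) n_pos by (intro log_mult_pos) auto
    moreover have "log 2 (4 :: real) = 2" using log_pow_cancel[of "2 :: real" 2] by simp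
    ultimately show ?thesis by (simp add: l_def log_def)
  qed
  also have "2 + l / ln 2 \<le> 2 + 2 * l"
  proof -
    have "1 / 2 \<le> ln (2 :: real)" using ln2_ge_two_thirds by simp
    then have "l * 1 \<le> l * (2 * ln 2)" using l by (intro mult_left_mono) auto
    then show ?thesis by (simp add: divide_le_eq)
  qed
  finally have log_N1: "log 2 (1 + N) \<le> 2 + 2 * l" .
  have "log 2 (N\<^sup>2 / fst b1) = 2 * log 2 N" using N r(1) by (simp add: log_nat_power)
  then have "160 + 209 * log 2 (N\<^sup>2 / fst b1) + 60 * log 2 (1 + N)
      = 160 + 418 * log 2 N + 60 * log 2 (1 + N)" by simp
  also have "\<dots> \<le> 160 + 418 * (2 + 2 * l) + 60 * (2 + 2 * l)"
    using log_N log_N1 by (intro add_mono mult_left_mono order_refl) auto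
  \<comment> \<open>The constants add up to 1116 and the coefficient of \<open>l\<close> to
    956.\<close>
  also have "\<dots> \<le> 1200 * (1 + l)" using l by simp
  finally have "160 + 209 * log 2 (N\<^sup>2 / fst b1) + 60 * log 2 (1 + N) \<le> 1200 * (1 + l)" .
  with run show ?thesis unfolding r(3) l_def by (rule runs_mono)
qed

end

theorem theorem3p10:
  "\<exists>c :: com.
     (\<forall>L n p b1 b2.
        rational_lattice L \<and> standard_basis L b1 b2 \<and> n > 0 \<and> p \<in> hyp n \<longrightarrow>
        (\<exists>t s. exec c (input_state n p b1 b2) t s \<and> result s = nextpt n L p)) \<and>
     (\<exists>C :: real. \<forall>L n p b1 b2 t s.
        rational_lattice L \<and> reduced_lattice L \<and> standard_basis L b1 b2 \<and>
        n > 0 \<and> p \<in> hyp n \<and> snd p \<notin> {1<..<2} \<and>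
        exec c (input_state n p b1 b2) t s \<longrightarrow>
        real t \<le> C * (1 + ln (n + lattice_det L)))"
proof (rule exI[of _ next_point], intro conjI allI impI, goal_cases)
  case (1 L n p b1 b2)
  then interpret standard_walk n L p b1 b2 by unfold_locales auto
  obtain M A where bounds: "\<And>u w. enclosing (fst b1 * snd b2) start u w \<Longrightarrow> fst u \<le> M"
    "\<And>u w. enclosing (fst b1 * snd b2) start u w \<Longrightarrow> snd u < 0 \<Longrightarrow> snd p \<le> A * (- snd u)"
    "A \<ge> 0" "fst b1 \<le> M"
    using enclosing_bounds_rational 1 by metis
  have "runs next_point (input_state n p b1 b2) (160 + 209 * log 2 (M / fst b1) + 60 * log 2 (1 + A))
      (\<lambda>s'. result s' = nextpt n L p)"
    by (rule runs_next_point) (use bounds in blast)+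
  then show ?case
    by (auto simp: runs_def)
next
  case 2
  have "real t \<le> 1200 * (1 + ln (n + lattice_det L))"
    if *: "rational_lattice L \<and> reduced_lattice L \<and> standard_basis L b1 b2 \<and>
        n > 0 \<and> p \<in> hyp n \<and> snd p \<notin> {1<..<2} \<and> exec next_point (input_state n p b1 b2) t s"
    for L n p b1 b2 t s
  proof -
    interpret standard_walk n L p b1 b2 using * by unfold_locales auto
    obtain t' s' where "exec next_point (input_state n p b1 b2) t' s'"
      and "real t' \<le> 1200 * (1 + ln (n + lattice_det L))"
      using runs_next_point_reduced * unfolding runs_def by blast
    \<comment> \<open>Determinism identifies the given run with the one constructed.\<close>
    then show ?thesis using exec_deterministic * by blast
  qed
  then show ?case by blast
qed

end
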